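(* Let $k\ge2$ be a fixed integer, let $m$ be an integer with $1\le m\le k-1$, and let $c>0$ be a constant. Let $T\in\mathbb{R}^{n^k}$ be a deterministic order-$k$ tensor, denote $t_{\max}:=\max_{i_1,\dots,i_k\in[n]}|t_{i_1,\dots,i_k}|$, let $p\in[0,1]$ satisfy $p\ge\frac{c\log n}{n^m}$, and let $\tilde T$ be the random tensor obtained by uniformly sampling the entries of $T$ with probability $p$: independently for each index, $$\tilde t_{i_1,\dots,i_k}=\begin{cases}t_{i_1,\dots,i_k}&\text{with probability }p,\\0&\text{with probability }1-p.\end{cases}$$ Then for any $r>0$ there exists a constant $C>0$ depending on $r,k,c$ such that with probability at least $1-n^{-r}$, $$\|\tilde T-pT\|\le\begin{cases}Ct_{\max}\sqrt{n^mp}&\text{if }k/2\le m\le k-1,\\ Ct_{\max}\sqrt{n^mp}\,\log^{\frac{k-1}{m}-1}(n)&\text{if }1\le m<k/2,\ k/m\notin\mathbb{Z},\\ Ct_{\max}\sqrt{n^mp}\,\log^{\frac km-2}(n)&\text{if }1\le m<k/2,\ k/m\in\mathbb{Z}.\end{cases}$$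
   Context: $[n]=\{1,\dots,n\}$, and $\mathbb{R}^{n^k}$ denotes the set of real order-$k$ tensors of dimension $n\times\cdots\times n$. The spectral norm of $T\in\mathbb{R}^{n^k}$ is $$\|T\|:=\sup_{\|x_1\|_2=\cdots=\|x_k\|_2=1}\Big|\sum_{i_1,\dots,i_k\in[n]}t_{i_1,\dots,i_k}x_{1,i_1}\cdots x_{k,i_k}\Big|,$$ the supremum being over unit vectors in $\mathbb{R}^n$. $\log^{a}(n)=(\log n)^a$. *)

theory Defs
  imports "HOL-Probability.Probability"
begin

text \<open>
  The dimension \<open>n\<close> has to range below the existential quantifier over the constant, so tensors are
  not indexed by types.  A multi-index is an extensional function from \<open>{1..k}\<close> to \<open>{1..n}\<close>, and an
  order-\<open>k\<close> tensor of dimension \<open>n\<close> is a real function on multi-indices; its values outside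
  \<open>multi_indices k n\<close> play no role.  Likewise only the entries \<open>1..n\<close> of a vector matter.
\<close>

definition multi_indices :: "nat \<Rightarrow> nat \<Rightarrow> (nat \<Rightarrow> nat) set" where
  "multi_indices k n = {1..k} \<rightarrow>\<^sub>E {1..n}"

definition spectral_norm :: "nat \<Rightarrow> nat \<Rightarrow> ((nat \<Rightarrow> nat) \<Rightarrow> real) \<Rightarrow> real" where
  "spectral_norm k n T =
     (SUP x \<in> {x :: nat \<Rightarrow> nat \<Rightarrow> real. \<forall>j\<in>{1..k}. L2_set (x j) {1..n} = 1}.
        \<bar>\<Sum>i\<in>multi_indices k n. T i * (\<Prod>j\<in>{1..k}. x j (i j))\<bar>)"

definition max_entry :: "nat \<Rightarrow> nat \<Rightarrow> ((nat \<Rightarrow> nat) \<Rightarrow> real) \<Rightarrow> real" where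
  "max_entry k n T = Max ((\<lambda>i. \<bar>T i\<bar>) ` multi_indices k n)"

text \<open>
  The law of the sampled tensor.  Working with the law itself, rather than with a random variable
  on an arbitrary probability space, keeps constants from depending on the type of that space.
\<close>

definition sampled_tensor ::
    "nat \<Rightarrow> nat \<Rightarrow> ((nat \<Rightarrow> nat) \<Rightarrow> real) \<Rightarrow> real \<Rightarrow> ((nat \<Rightarrow> nat) \<Rightarrow> real) pmf" where
  "sampled_tensor k n T p =
     Pi_pmf (multi_indices k n) 0 (\<lambda>i. map_pmf (\<lambda>b. if b then T i else 0) (bernoulli_pmf p))"

end

(*
  Group the indices into blocks of size at most m: a product of unit vectors over a block is a unit
  vector of dimension N = n^m, so the norm is at most that of an order-K tensor of dimension N with
  K = ceil(k/m), and p >= c' log N / N.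

  For such tensors follow Kahn-Szemeredi and Feige-Ofek.  On a net of the ball, split the entries
  at |y_1 ... y_K| = tau := sqrt(p/N).  The light part has exponential tails beyond N tau = sqrt(Np)
  that beat the net.  The mean of the heavy part is at most p / tau = N tau.  The sampled heavy part
  is bounded on dyadic level sets, using that with high probability every fibre over K - 1
  coordinates has O(Np) sampled entries, and every box is either close to its expected count or
  satisfies an entropic discrepancy bound.  On each tuple of level sets the contribution decays
  geometrically in one coordinate; either the masses of the level sets sum it over the others, or
  only that of the largest set is available, and the K - 2 remaining coordinates each cost a factor
  log N, the number of levels.
*)
theory Submission
  imports Defs
begin

subsection \<open>Exponential moments of Bernoulli sampling\<close>

text \<open>The threshold \<tau> comes from the light part. Scaled by \<open>1 / \<tau>\<close>, its
  exponential moment has exponent at most \<open>p / \<tau>\<^sup>2\<close>, and this has to match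
  the logarithm of the size of the net, which is of order \<open>N\<close>. Setting
  \<open>p / \<tau>\<^sup>2 = N\<close> also makes the bound \<open>p / \<tau>\<close> for the mean
  of the heavy part equal to the target \<open>N * \<tau> = sqrt (N * p)\<close>. Blocks are forced
  by sparsity: a fibre of the original tensor has \<open>n\<close> entries, and for
  \<open>m > 1\<close> its expected count \<open>n * p\<close> may be far below \<open>ln n\<close>,
  so counts do not concentrate. A fibre along a block of length \<open>m\<close> has
  \<open>n ^ m\<close> entries, and \<open>n ^ m * p \<ge> c * ln n\<close>. The logarithms have a
  definite origin: a union bound over boxes costs the entropy of the largest side, so the
  discrepancy bound knows the mass of a single level set. For \<open>K = 2\<close> the two
  coordinates are then both accounted for, one by mass and one by geometric decay.\<close>

lemma finite_set_pmf_Pi_pmf: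
  assumes "finite A" "\<And>x. x \<in> A \<Longrightarrow> finite (set_pmf (p x))"
  shows "finite (set_pmf (Pi_pmf A d p))"
  using assms by (auto simp: set_Pi_pmf intro!: finite_PiE_dflt)

lemma exp_markov_pmf:
  fixes Z :: "'a \<Rightarrow> real"
  assumes "finite (set_pmf P)" and "measure_pmf.expectation P (\<lambda>x. exp (Z x)) \<le> M"
  shows "measure_pmf.prob P {x. t \<le> Z x} \<le> M * exp (- t)"
proof -
  have "measure_pmf.prob P {x. t \<le> Z x} = measure_pmf.prob P {x. exp t \<le> exp (Z x)}"
    by simp
  also have "\<dots> \<le> measure_pmf.expectation P (\<lambda>x. exp (Z x)) / exp t"
    using integral_Markov_inequality_measure[of "measure_pmf P" "\<lambda>x. exp (Z x)" UNIV "exp t"] assms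
    by (simp add: integrable_measure_pmf_finite)
  also have "\<dots> \<le> M / exp t"
    using assms by (simp add: divide_right_mono)
  finally show ?thesis
    by (simp add: exp_minus field_simps)
qed

lemma prob_UN_le_card_mult:
  assumes "finite F" "\<And>f. f \<in> F \<Longrightarrow> measure_pmf.prob P (E f) \<le> b"
  shows "measure_pmf.prob P (\<Union>f\<in>F. E f) \<le> real (card F) * b"
proof -
  have "measure_pmf.prob P (\<Union>f\<in>F. E f) \<le> (\<Sum>f\<in>F. measure_pmf.prob P (E f))"
    by (rule measure_pmf.finite_measure_subadditive_finite) (use assms in auto)
  also have "\<dots> \<le> real (card F) * b"
    using sum_bounded_above[of F "\<lambda>f. measure_pmf.prob P (E f)" b] assms by simp
  finally show ?thesis .
qed

abbreviation sampling :: "'w set \<Rightarrow> real \<Rightarrow> ('w \<Rightarrow> bool) pmf" where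
  "sampling \<Omega> p \<equiv> Pi_pmf \<Omega> False (\<lambda>_. bernoulli_pmf p)"

lemma expectation_exp_sampling:
  fixes c :: "'w \<Rightarrow> real"
  assumes "finite \<Omega>" "0 \<le> p" "p \<le> 1"
  shows "measure_pmf.expectation (sampling \<Omega> p) (\<lambda>B. exp (\<Sum>w\<in>\<Omega>. c w * of_bool (B w)))
           \<le> exp (p * (\<Sum>w\<in>\<Omega>. exp (c w) - 1))"
proof -
  have "measure_pmf.expectation (sampling \<Omega> p) (\<lambda>B. exp (\<Sum>w\<in>\<Omega>. c w * of_bool (B w)))
      = measure_pmf.expectation (sampling \<Omega> p) (\<lambda>B. \<Prod>w\<in>\<Omega>. exp (c w * of_bool (B w)))"
    by (simp only: exp_sum[OF assms(1)])
  also have "\<dots> = (\<Prod>w\<in>\<Omega>. measure_pmf.expectation (bernoulli_pmf p) (\<lambda>b. exp (c w * of_bool b)))"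
    by (rule expectation_prod_Pi_pmf) (use assms in \<open>auto intro!: integrable_measure_pmf_finite\<close>)
  also have "\<dots> = (\<Prod>w\<in>\<Omega>. 1 + p * (exp (c w) - 1))"
    using assms by (intro prod.cong) (auto simp: algebra_simps)
  also have "\<dots> \<le> (\<Prod>w\<in>\<Omega>. exp (p * (exp (c w) - 1)))"
  proof (rule prod_mono, safe)
    fix w
    have "p * (exp (c w) - 1) \<ge> p * (-1)"
      using assms by (intro mult_left_mono) auto
    then show "0 \<le> 1 + p * (exp (c w) - 1)" using assms by linarith
    show "1 + p * (exp (c w) - 1) \<le> exp (p * (exp (c w) - 1))"
      by (rule exp_ge_add_one_self)
  qed
  also have "\<dots> = exp (p * (\<Sum>w\<in>\<Omega>. exp (c w) - 1))"
    using assms by (simp add: exp_sum sum_distrib_left)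
  finally show ?thesis .
qed

text \<open>Since \<open>exp x - 1 - x \<le> x\<^sup>2\<close> for
  \<open>\<bar>x\<bar> \<le> 1\<close>, centring removes the linear term and leaves an exponent of
  variance type.\<close>

lemma expectation_exp_centered_sampling:
  fixes c :: "'w \<Rightarrow> real"
  assumes "finite \<Omega>" "0 \<le> p" "p \<le> 1" "\<And>w. w \<in> \<Omega> \<Longrightarrow> \<bar>c w\<bar> \<le> 1"
  shows "measure_pmf.expectation (sampling \<Omega> p) (\<lambda>B. exp (\<Sum>w\<in>\<Omega>. c w * (of_bool (B w) - p)))
           \<le> exp (p * (\<Sum>w\<in>\<Omega>. (c w)\<^sup>2))"
proof -
  have "measure_pmf.expectation (sampling \<Omega> p) (\<lambda>B. exp (\<Sum>w\<in>\<Omega>. c w * (of_bool (B w) - p)))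
      = measure_pmf.expectation (sampling \<Omega> p)
          (\<lambda>B. exp (- p * (\<Sum>w\<in>\<Omega>. c w)) * exp (\<Sum>w\<in>\<Omega>. c w * of_bool (B w)))"
    by (simp flip: exp_add add: algebra_simps sum_subtractf sum_distrib_left sum_negf)
  also have "\<dots> = exp (- p * (\<Sum>w\<in>\<Omega>. c w)) *
      measure_pmf.expectation (sampling \<Omega> p) (\<lambda>B. exp (\<Sum>w\<in>\<Omega>. c w * of_bool (B w)))"
    by simp
  also have "\<dots> \<le> exp (- p * (\<Sum>w\<in>\<Omega>. c w)) * exp (p * (\<Sum>w\<in>\<Omega>. exp (c w) - 1))"
    by (intro mult_left_mono expectation_exp_sampling assms) auto
  also have "\<dots> = exp (p * (\<Sum>w\<in>\<Omega>. exp (c w) - 1 - c w))"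
    by (simp flip: exp_add add: algebra_simps sum_subtractf sum.distrib sum_negf sum_distrib_left)
  also have "\<dots> \<le> exp (p * (\<Sum>w\<in>\<Omega>. (c w)\<^sup>2))"
  proof -
    have "exp (c w) - 1 - c w \<le> (c w)\<^sup>2" if "w \<in> \<Omega>" for w
    proof (cases "c w \<ge> 0")
      case True
      then show ?thesis using exp_bound[of "c w"] assms(4)[OF that] by simp
    next
      case False
      then have "(1 - c w) * exp (c w) \<le> 1"
        using exp_ge_add_one_self[of "- c w"] by (simp add: exp_minus field_simps)
      \<comment> \<open>The product equals \<open>1 - (c w) ^ 3\<close>, which is at least 1 for
        negative \<open>c w\<close>; the positive factor \<open>1 - c w\<close> then
        cancels.\<close>
      also have "1 \<le> (1 - c w) * (1 + c w + (c w)\<^sup>2)"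
        using False by (simp add: algebra_simps power2_eq_square mult_le_0_iff)
      finally have "exp (c w) \<le> 1 + c w + (c w)\<^sup>2" using False by simp
      then show ?thesis by simp
    qed
    then show ?thesis using assms by (auto intro!: mult_left_mono sum_mono)
  qed
  finally show ?thesis .
qed

text \<open>\<open>\<mu>\<close> is any upper bound for the mean, because counts in boxes are
  compared with products of side lengths. The parameter \<open>l\<close> stays free: it becomes 1
  for degrees and \<open>ln (t / \<mu>)\<close> for the entropic tail.\<close>

lemma sampling_chernoff:
  assumes "finite \<Omega>" "S \<subseteq> \<Omega>" "0 \<le> p" "p \<le> 1" "p * real (card S) \<le> \<mu>" "0 \<le> l"
  shows "measure_pmf.prob (sampling \<Omega> p) {B. t \<le> real (card {w\<in>S. B w})}
           \<le> exp (\<mu> * (exp l - 1) - l * t)"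
proof (cases "l = 0")
  case False
  then have l: "l > 0" using assms by simp
  have eq: "(\<Sum>w\<in>\<Omega>. (if w \<in> S then l else 0) * of_bool (B w)) = l * real (card {w\<in>S. B w})" for B
  proof -
    have "(\<Sum>w\<in>\<Omega>. (if w \<in> S then l else 0) * of_bool (B w)) = (\<Sum>w\<in>{w\<in>S. B w}. l)"
      using assms by (intro sum.mono_neutral_cong_right) auto
    then show ?thesis by simp
  qed
  have "measure_pmf.expectation (sampling \<Omega> p) (\<lambda>B. exp (l * real (card {w\<in>S. B w})))
      \<le> exp (p * (\<Sum>w\<in>\<Omega>. exp (if w \<in> S then l else 0) - 1))"
    using expectation_exp_sampling[OF assms(1,3,4), of "\<lambda>w. if w \<in> S then l else 0"]
    unfolding eq .
  also have "(\<Sum>w\<in>\<Omega>. exp (if w \<in> S then l else 0) - 1) = (\<Sum>w\<in>S. exp l - 1)"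
    using assms by (intro sum.mono_neutral_cong_right) auto
  also have "exp (p * (\<Sum>w\<in>S. exp l - 1)) \<le> exp (\<mu> * (exp l - 1))"
    using mult_right_mono[OF assms(5), of "exp l - 1"] l by (simp add: mult.assoc)
  finally have "measure_pmf.prob (sampling \<Omega> p) {B. l * t \<le> l * real (card {w\<in>S. B w})}
      \<le> exp (\<mu> * (exp l - 1)) * exp (- (l * t))"
    by (intro exp_markov_pmf finite_set_pmf_Pi_pmf assms) auto
  then show ?thesis using l by (simp flip: exp_add)
qed (use assms in auto)

text \<open>The choice \<open>l = ln (t / \<mu>)\<close> gives the exponent
  \<open>t - \<mu> - t * ln (t / \<mu>)\<close>. The logarithm is at least 2, so half of the last
  term absorbs \<open>t\<close>.\<close>

lemma sampling_chernoff_entropy: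
  assumes "finite \<Omega>" "S \<subseteq> \<Omega>" "0 \<le> p" "p \<le> 1" "p * real (card S) \<le> \<mu>"
    and "0 < \<mu>" "exp 2 * \<mu> \<le> t"
  shows "measure_pmf.prob (sampling \<Omega> p) {B. t \<le> real (card {w\<in>S. B w})}
           \<le> exp (- t * ln (t / \<mu>) / 2)"
proof -
  have t: "t > 0" using assms(6,7) by (smt (verit) exp_gt_zero mult_pos_pos)
  have ge: "exp 2 \<le> t / \<mu>" using assms by (simp add: field_simps)
  then have l2: "2 \<le> ln (t / \<mu>)"
    using t assms(6) by (subst ln_ge_iff) auto
  have "measure_pmf.prob (sampling \<Omega> p) {B. t \<le> real (card {w\<in>S. B w})}
      \<le> exp (\<mu> * (exp (ln (t / \<mu>)) - 1) - ln (t / \<mu>) * t)"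
    using l2 by (intro sampling_chernoff assms) auto
  also have "\<dots> \<le> exp (- t * ln (t / \<mu>) / 2)"
  proof -
    have "\<mu> * (exp (ln (t / \<mu>)) - 1) = t - \<mu>"
      using t assms(6) by (simp add: field_simps)
    moreover have "t * ln (t / \<mu>) \<ge> t * 2"
      using t l2 by (intro mult_left_mono) auto
    ultimately show ?thesis using assms(6) by (simp add: algebra_simps)
  qed
  finally show ?thesis .
qed

subsection \<open>A net of the Euclidean ball\<close>

text \<open>The points of the unit ball on a grid of mesh \<open>1 / (2 * sqrt N)\<close>: in mesh
  units the squared radius is \<open>4 * N\<close>. An integer is bounded by its square, so the cube
  contains all these points; extensionality of \<open>h\<close> fixes the values off
  \<open>I\<close>, which keeps the set finite.\<close>

definition ball_net :: "'a set \<Rightarrow> nat \<Rightarrow> ('a \<Rightarrow> real) set" where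
  "ball_net I N = (\<lambda>h u. real_of_int (h u) / (2 * sqrt N)) `
     {h \<in> I \<rightarrow>\<^sub>E {- int (4 * N)..int (4 * N)}. (\<Sum>u\<in>I. (h u)\<^sup>2) \<le> int (4 * N)}"

lemma finite_ball_net: "finite I \<Longrightarrow> finite (ball_net I N)"
  unfolding ball_net_def
  by (intro finite_imageI finite_subset[OF Collect_subset[of "I \<rightarrow>\<^sub>E _", unfolded Collect_mem_eq]]) (auto intro: finite_PiE)

lemma ball_net_norm:
  assumes "z \<in> ball_net I N" "N > 0"
  shows "(\<Sum>u\<in>I. (z u)\<^sup>2) \<le> 1"
proof -
  obtain h where h: "(\<Sum>u\<in>I. (h u)\<^sup>2) \<le> int (4 * N)" "z = (\<lambda>u. real_of_int (h u) / (2 * sqrt N))"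
    using assms unfolding ball_net_def by auto
  have "(\<Sum>u\<in>I. (z u)\<^sup>2) = real_of_int (\<Sum>u\<in>I. (h u)\<^sup>2) / (4 * N)"
    using assms(2) by (simp add: h(2) power_divide power_mult_distrib sum_divide_distrib)
  also have "\<dots> \<le> real_of_int (int (4 * N)) / (4 * N)"
    by (intro divide_right_mono) (use h(1) in linarith, simp)
  also have "\<dots> = 1" using assms by simp
  finally show ?thesis .
qed

lemma abs_le_square_int: "\<bar>x :: int\<bar> \<le> x\<^sup>2"
proof (cases "x = 0")
  case False
  then have "\<bar>x\<bar> * 1 \<le> \<bar>x\<bar> * \<bar>x\<bar>" by (intro mult_left_mono) auto
  then show ?thesis by (simp add: power2_eq_square flip: abs_mult)
qed simp

lemma sum_half_powers_le: "(\<Sum>s<n. (1/2) ^ s :: real) \<le> 2"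
  by (simp add: sum_gp_strict divide_simps del: power_divide power_one_over)

lemma sum_half_power_abs_le:
  "(\<Sum>x\<in>{- int M..int M}. (1/2 :: real) ^ nat \<bar>x\<bar>) \<le> 4"
proof -
  have "(\<Sum>x\<in>{- int M..int M}. (1/2 :: real) ^ nat \<bar>x\<bar>)
      \<le> (\<Sum>x\<in>int ` {..M} \<union> (\<lambda>s. - int s) ` {..M}. (1/2 :: real) ^ nat \<bar>x\<bar>)"
  proof (rule sum_mono2)
    show "{- int M..int M} \<subseteq> int ` {..M} \<union> (\<lambda>s. - int s) ` {..M}"
    proof
      fix x assume x: "x \<in> {- int M..int M}"
      have "x = int (nat x) \<or> x = - int (nat (-x))" by linarith
      moreover have "nat x \<le> M" "nat (-x) \<le> M" using x by auto
      ultimately show "x \<in> int ` {..M} \<union> (\<lambda>s. - int s) ` {..M}" by blast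
    qed
  qed auto
  also have "\<dots> \<le> (\<Sum>x\<in>int ` {..M}. (1/2 :: real) ^ nat \<bar>x\<bar>)
      + (\<Sum>x\<in>(\<lambda>s. - int s) ` {..M}. (1/2 :: real) ^ nat \<bar>x\<bar>)"
    by (subst sum.union_inter[symmetric]) (auto intro!: sum_nonneg)
  also have "\<dots> = (\<Sum>s\<le>M. (1/2) ^ s) + (\<Sum>s\<le>M. (1/2) ^ s)"
    by (subst (1 2) sum.reindex) (auto simp: inj_on_def)
  also have "\<dots> \<le> 4"
    using sum_half_powers_le[of "Suc M"] by (simp add: lessThan_Suc_atMost)
  finally show ?thesis .
qed

text \<open>Every admissible \<open>h\<close> satisfies \<open>1 \<le> 2 ^ (4 * N) * (\<Prod>u\<in>I. (1/2) ^ \<bar>h u\<bar>)\<close>; summing this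
  over the whole box factorises.\<close>
lemma card_ball_net:
  assumes "finite I" "card I \<le> N"
  shows "real (card (ball_net I N)) \<le> 64 ^ N"
proof -
  let ?B = "I \<rightarrow>\<^sub>E {- int (4 * N)..int (4 * N)}"
  let ?H = "{h \<in> ?B. (\<Sum>u\<in>I. (h u)\<^sup>2) \<le> int (4 * N)}"
  have finB: "finite ?B" using assms by (intro finite_PiE) auto
  have ge: "1 \<le> 2 ^ (4 * N) * (\<Prod>u\<in>I. (1/2 :: real) ^ nat \<bar>h u\<bar>)" if "h \<in> ?H" for h
  proof -
    have "int (\<Sum>u\<in>I. nat \<bar>h u\<bar>) \<le> (\<Sum>u\<in>I. (h u)\<^sup>2)"
      unfolding of_nat_sum
    proof (rule sum_mono)
      fix u
      show "int (nat \<bar>h u\<bar>) \<le> (h u)\<^sup>2" using abs_le_square_int[of "h u"] by simp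
    qed
    also have "\<dots> \<le> int (4 * N)" using that by blast
    finally have "(\<Sum>u\<in>I. nat \<bar>h u\<bar>) \<le> 4 * N" by (simp only: of_nat_le_iff)
    then have "(1/2 :: real) ^ (4 * N) \<le> (1/2) ^ (\<Sum>u\<in>I. nat \<bar>h u\<bar>)"
      by (intro power_decreasing) auto
    then show ?thesis by (simp add: power_sum field_simps)
  qed
  have "real (card (ball_net I N)) \<le> real (card ?H)"
    unfolding ball_net_def using finB by (intro of_nat_mono card_image_le) auto
  also have "\<dots> \<le> (\<Sum>h\<in>?H. 2 ^ (4 * N) * (\<Prod>u\<in>I. (1/2 :: real) ^ nat \<bar>h u\<bar>))"
    using sum_mono[of ?H "\<lambda>_. 1" "\<lambda>h. 2 ^ (4 * N) * (\<Prod>u\<in>I. (1/2 :: real) ^ nat \<bar>h u\<bar>)"] ge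
    by simp
  also have "\<dots> \<le> (\<Sum>h\<in>?B. 2 ^ (4 * N) * (\<Prod>u\<in>I. (1/2 :: real) ^ nat \<bar>h u\<bar>))"
    using finB by (intro sum_mono2) (auto intro!: mult_nonneg_nonneg prod_nonneg)
  also have "\<dots> = 2 ^ (4 * N) * (\<Prod>u\<in>I. \<Sum>x\<in>{- int (4 * N)..int (4 * N)}. (1/2 :: real) ^ nat \<bar>x\<bar>)"
    using assms by (subst prod_sum_PiE) (auto simp: sum_distrib_left)
  also have "\<dots> \<le> 2 ^ (4 * N) * (\<Prod>u\<in>I. 4)"
    using sum_half_power_abs_le[of "4 * N"] by (intro mult_left_mono prod_mono) (auto intro!: sum_nonneg)
  also have "\<dots> \<le> 2 ^ (4 * N) * 4 ^ N"
    using assms by (simp add: power_increasing)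
  also have "\<dots> = (64 :: real) ^ N"
    by (simp add: power_mult flip: power_mult_distrib)
  finally show ?thesis .
qed

text \<open>Rounding every coordinate towards 0 does not increase its modulus, so the result stays
  in the ball. Each coordinate moves by at most one mesh width, and \<open>N\<close> squared mesh
  widths add up to 1/4.\<close>

lemma linear_form_net_approx:
  fixes y :: "'a \<Rightarrow> real"
  assumes "finite I" "card I \<le> N" "N > 0" and y: "(\<Sum>u\<in>I. (y u)\<^sup>2) \<le> 1"
  obtains z where "z \<in> ball_net I N" "(\<Sum>u\<in>I. (y u - z u)\<^sup>2) \<le> 1 / 4"
proof -
  define d where "d = 2 * sqrt N"
  have d: "d > 0" "d\<^sup>2 = 4 * N" using assms by (auto simp: d_def power_mult_distrib)
  define h where "h = (\<lambda>u\<in>I. if y u \<ge> 0 then \<lfloor>d * y u\<rfloor> else \<lceil>d * y u\<rceil>)"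
  have abs: "\<bar>real_of_int (h u)\<bar> \<le> \<bar>d * y u\<bar>" "\<bar>d * y u - h u\<bar> \<le> 1" if "u \<in> I" for u
  proof -
    have "d * y u \<ge> 0" if "y u \<ge> 0" using that d by simp
    moreover have "d * y u \<le> 0" if "\<not> y u \<ge> 0" using that d by (simp add: mult_le_0_iff)
    ultimately have "0 \<le> real_of_int (h u) \<and> real_of_int (h u) \<le> d * y u \<and> d * y u - 1 \<le> h u \<or>
        real_of_int (h u) \<le> 0 \<and> d * y u \<le> h u \<and> h u \<le> d * y u + 1"
      using that unfolding h_def by (simp del: mult_eq_0_iff; linarith)
    then show "\<bar>real_of_int (h u)\<bar> \<le> \<bar>d * y u\<bar>" "\<bar>d * y u - h u\<bar> \<le> 1" by linarith+
  qed
  have "real_of_int (\<Sum>u\<in>I. (h u)\<^sup>2) = (\<Sum>u\<in>I. \<bar>real_of_int (h u)\<bar>\<^sup>2)" by simp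
  also have "\<dots> \<le> (\<Sum>u\<in>I. \<bar>d * y u\<bar>\<^sup>2)"
    by (intro sum_mono power_mono abs) auto
  also have "\<dots> = d\<^sup>2 * (\<Sum>u\<in>I. (y u)\<^sup>2)" by (simp add: power_mult_distrib sum_distrib_left)
  also have "\<dots> \<le> d\<^sup>2 * 1" by (intro mult_left_mono y) auto
  finally have "real_of_int (\<Sum>u\<in>I. (h u)\<^sup>2) \<le> real_of_int (int (4 * N))" by (simp add: d)
  then have sq: "(\<Sum>u\<in>I. (h u)\<^sup>2) \<le> int (4 * N)" by (simp only: of_int_le_iff)
  have "h \<in> I \<rightarrow>\<^sub>E {- int (4 * N)..int (4 * N)}"
  proof (rule PiE_I)
    fix u assume u: "u \<in> I"
    have "\<bar>h u\<bar> \<le> (h u)\<^sup>2" by (rule abs_le_square_int)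
    also have "\<dots> \<le> (\<Sum>u\<in>I. (h u)\<^sup>2)"
      using assms u by (intro member_le_sum) auto
    finally show "h u \<in> {- int (4 * N)..int (4 * N)}" using sq by auto
  qed (simp add: h_def)
  then have "(\<lambda>u. real_of_int (h u) / d) \<in> ball_net I N"
    using sq unfolding ball_net_def d_def by blast
  moreover have "(\<Sum>u\<in>I. (y u - real_of_int (h u) / d)\<^sup>2) \<le> 1 / 4"
  proof -
    have "(\<Sum>u\<in>I. (y u - real_of_int (h u) / d)\<^sup>2) = (\<Sum>u\<in>I. \<bar>d * y u - h u\<bar>\<^sup>2) / d\<^sup>2"
      using d(1) by (simp add: sum_divide_distrib power_divide[symmetric] diff_divide_distrib)
    also have "\<dots> \<le> (\<Sum>u\<in>I. 1\<^sup>2) / d\<^sup>2"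
      by (intro divide_right_mono sum_mono power_mono abs) auto
    also have "\<dots> \<le> 1 / 4" using assms by (simp add: d field_simps)
    finally show ?thesis .
  qed
  ultimately show ?thesis by (rule that)
qed

text \<open>At the maximiser \<open>G / \<parallel>G\<parallel>\<close> of the linear form, the rounding error costs at most half of
  \<open>\<parallel>G\<parallel>\<close>, which is absorbed.\<close>
lemma linear_form_le_twice_net:
  fixes G y :: "'a \<Rightarrow> real"
  assumes "finite I" "card I \<le> N" "N > 0" and y: "(\<Sum>u\<in>I. (y u)\<^sup>2) \<le> 1"
    and net: "\<And>z. z \<in> ball_net I N \<Longrightarrow> \<bar>\<Sum>u\<in>I. G u * z u\<bar> \<le> b"
  shows "\<bar>\<Sum>u\<in>I. G u * y u\<bar> \<le> 2 * b"
proof -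
  define g where "g = L2_set G I"
  have CS: "\<bar>\<Sum>u\<in>I. G u * x u\<bar> \<le> g * e" if "(\<Sum>u\<in>I. (x u)\<^sup>2) \<le> e\<^sup>2" "e \<ge> 0" for x e
  proof -
    have "\<bar>\<Sum>u\<in>I. G u * x u\<bar> \<le> (\<Sum>u\<in>I. \<bar>G u\<bar> * \<bar>x u\<bar>)"
      using sum_abs[of "\<lambda>u. G u * x u" I] by (simp add: abs_mult)
    also have "\<dots> \<le> g * L2_set x I" unfolding g_def by (rule L2_set_mult_ineq)
    also have "L2_set x I \<le> e" using that unfolding L2_set_def by (simp add: real_le_lsqrt)
    finally show ?thesis by (simp add: g_def L2_set_nonneg mult_left_mono)
  qed
  have gsq: "g\<^sup>2 = (\<Sum>u\<in>I. (G u)\<^sup>2)" unfolding g_def L2_set_def by (simp add: sum_nonneg)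
  have "g \<ge> 0" by (simp add: g_def L2_set_nonneg)
  have "g \<le> 2 * b"
  proof (cases "g = 0")
    case True
    obtain z where "z \<in> ball_net I N" using linear_form_net_approx[OF assms(1-4)] by blast
    from net[OF this] have "b \<ge> 0" by linarith
    then show ?thesis using True by simp
  next
    case False
    then have g: "g > 0" using \<open>g \<ge> 0\<close> by simp
    have unit: "(\<Sum>u\<in>I. (G u / g)\<^sup>2) \<le> 1" using g by (simp add: power_divide gsq flip: sum_divide_distrib)
    obtain z where z: "z \<in> ball_net I N" "(\<Sum>u\<in>I. (G u / g - z u)\<^sup>2) \<le> 1 / 4"
      by (rule linear_form_net_approx[OF assms(1-3) unit])
    have "g = (\<Sum>u\<in>I. G u * (G u / g))"
    proof -
      have "g = g\<^sup>2 / g" using g by (simp add: power2_eq_square)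
      also have "\<dots> = (\<Sum>u\<in>I. G u * (G u / g))"
        by (simp add: gsq sum_divide_distrib power2_eq_square[of "G _"])
      finally show ?thesis .
    qed
    also have "\<dots> = (\<Sum>u\<in>I. G u * z u) + (\<Sum>u\<in>I. G u * (G u / g - z u))"
      by (simp add: algebra_simps flip: sum.distrib)
    also have "\<dots> \<le> b + g * (1 / 2)"
      using net[OF z(1)] CS[of "\<lambda>u. G u / g - z u" "1/2"] z(2) by (simp add: power2_eq_square)
    finally show ?thesis by simp
  qed
  then show ?thesis using CS[of y 1] y by simp
qed

subsection \<open>Geometric sums over levels\<close>

text \<open>In each case where a peak bounds a contribution, its argument is known to lie on one
  particular side of 1. The symmetric form allows summation over all levels without recording which
  side it was.\<close>

definition peak :: "real \<Rightarrow> real" where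
  "peak x = min x (1 / x)"

lemma peak_nonneg: "x \<ge> 0 \<Longrightarrow> peak x \<ge> 0"
  by (simp add: peak_def)

lemma peak_eq_inverse: "x \<ge> 1 \<Longrightarrow> peak x = 1 / x"
  unfolding peak_def by (rule min_absorb2) (use mult_mono[of 1 x 1 x] in \<open>simp add: divide_le_eq\<close>)

lemma peak_eq_self: "0 < x \<Longrightarrow> x \<le> 1 \<Longrightarrow> peak x = x"
  unfolding peak_def by (rule min_absorb1) (simp add: le_divide_eq mult_le_one)

text \<open>As \<open>s\<close> grows, \<open>c / 2 ^ s\<close> passes \<open>1\<close> at most once, and \<open>peak\<close> decays geometrically on both
  sides of \<open>1\<close>.\<close>
lemma sum_peak_geometric:
  assumes "0 < c"
  shows "(\<Sum>s<n. peak (c * (1/2) ^ s)) \<le> 4"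
proof -
  have small: "(\<Sum>s<n. peak (c * (1/2) ^ s)) \<le> 2 * c" if "0 < c" for c n
  proof -
    have "(\<Sum>s<n. peak (c * (1/2) ^ s)) \<le> (\<Sum>s<n. c * (1/2) ^ s)"
      by (intro sum_mono) (simp add: peak_def)
    also have "\<dots> \<le> c * 2"
      using that sum_half_powers_le[of n] by (simp only: sum_distrib_left[symmetric]) simp
    finally show ?thesis by simp
  qed
  \<comment> \<open>The sharper \<open>4 - 2 / c\<close> is what survives halving \<open>c\<close>:
    one step adds \<open>1 / c\<close> to \<open>4 - 4 / c\<close>. The passage through 1, where
    \<open>1 < c \<le> 2\<close>, comes down to \<open>(c - 1) * (c - 3) \<le> 0\<close>.\<close>
  have "(\<Sum>s<n. peak (c * (1/2) ^ s)) \<le> (if c \<le> 1 then 2 * c else 4 - 2 / c)"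
    using assms
  proof (induction n arbitrary: c)
    case 0
    then show ?case by (simp add: divide_le_eq)
  next
    case (Suc n)
    show ?case
    proof (cases "c \<le> 1")
      case True
      then show ?thesis using small[of c "Suc n"] Suc.prems by simp
    next
      case False
      have "(\<Sum>s<Suc n. peak (c * (1/2) ^ s)) = peak c + (\<Sum>s<n. peak (c / 2 * (1/2) ^ s))"
        by (subst sum.lessThan_Suc_shift) simp
      also have "\<dots> \<le> 1 / c + (if c / 2 \<le> 1 then 2 * (c / 2) else 4 - 2 / (c / 2))"
        using Suc.IH[of "c / 2"] False by (intro add_mono) (simp_all add: peak_eq_inverse)
      also have "\<dots> \<le> 4 - 2 / c"
      proof (cases "c / 2 \<le> 1")
        case True
        then have "(c - 1) * (c - 3) \<le> 0" using False by (simp add: mult_nonneg_nonpos)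
        then have "3 / c + c \<le> 4" using False by (simp add: field_simps)
        then show ?thesis using True by simp
      qed (use False in \<open>simp add: divide_right_mono\<close>)
      finally show ?thesis using False by simp
    qed
  qed
  also have "\<dots> \<le> 4" using assms by simp
  finally show ?thesis .
qed

text \<open>With the other coordinates frozen, coordinate \<open>i\<close> runs along a geometric
  progression and costs at most 4, whatever the scale \<open>h\<close>. The factors \<open>b\<close>
  pay for the others: masses have bounded sums, while the constant 1 yields the number of
  levels.\<close>

lemma sum_PiE_peak_le:
  fixes b :: "'j \<Rightarrow> nat \<Rightarrow> real"
  assumes "finite J" "i \<in> J" and b: "\<And>l s. b l s \<ge> 0"
    and h: "\<And>s. h s > 0" "\<And>s x. h (s(i := x)) = h s"
  shows "(\<Sum>s \<in> J \<rightarrow>\<^sub>E {..<S}. (\<Prod>l\<in>J - {i}. b l (s l)) * peak (h s * (1/2) ^ s i))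
           \<le> 4 * (\<Prod>l\<in>J - {i}. \<Sum>x<S. b l x)"
proof -
  have J: "J = insert i (J - {i})" using assms by auto
  let ?f = "\<lambda>s. (\<Prod>l\<in>J - {i}. b l (s l)) * peak (h s * (1/2) ^ s i)"
  have "sum ?f (J \<rightarrow>\<^sub>E {..<S}) = sum ?f ((\<lambda>(y, g). g(i := y)) ` ({..<S} \<times> (J - {i} \<rightarrow>\<^sub>E {..<S})))"
    by (subst J, subst PiE_insert_eq) simp
  also have "\<dots> = (\<Sum>(y, g)\<in>{..<S} \<times> (J - {i} \<rightarrow>\<^sub>E {..<S}). ?f (g(i := y)))"
    by (subst sum.reindex[OF inj_combinator]) (auto simp: case_prod_unfold)
  also have "\<dots> = (\<Sum>g\<in>J - {i} \<rightarrow>\<^sub>E {..<S}. \<Sum>y<S. ?f (g(i := y)))"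
    unfolding sum.cartesian_product[symmetric] by (rule sum.swap)
  also have "\<dots> = (\<Sum>g\<in>J - {i} \<rightarrow>\<^sub>E {..<S}. (\<Prod>l\<in>J - {i}. b l (g l)) * (\<Sum>y<S. peak (h g * (1/2) ^ y)))"
    by (intro sum.cong refl) (simp add: h sum_distrib_left)
  also have "\<dots> \<le> (\<Sum>g\<in>J - {i} \<rightarrow>\<^sub>E {..<S}. (\<Prod>l\<in>J - {i}. b l (g l)) * 4)"
    by (intro sum_mono mult_left_mono sum_peak_geometric h prod_nonneg) (auto simp: b)
  also have "\<dots> = 4 * (\<Prod>l\<in>J - {i}. \<Sum>x<S. b l x)"
    using assms by (subst prod_sum_PiE) (auto simp: sum_distrib_left sum_distrib_right mult.commute)
  finally show ?thesis .
qed

text \<open>For one tuple of level sets, the largest of which has \<open>n\<close> elements at level \<open>s\<close>: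
  \<open>a = n / 4 ^ s\<close>, \<open>q = N / 4 ^ s\<close>, \<open>A\<close> is the product of the quantities \<open>a\<close> over the other
  sets, \<open>\<sigma>\<close> is the weight in units of \<open>\<tau>\<close>, \<open>r\<close> is the ratio of the number of sampled entries to
  its (bound for the) expectation, and \<open>g\<close> is the contribution in units of \<open>N * \<tau>\<close>.\<close>
lemma heavy_case_analysis:
  fixes a A \<sigma> q r g C2 C3 :: real
  assumes a: "0 < a" "a \<le> 4" and A: "0 \<le> A" and s: "1 < \<sigma>" and q: "a \<le> q" "0 < q" and r: "0 < r"
    and g: "g = r * a * A / \<sigma>" and C: "C2 \<ge> 0" "C3 \<ge> 0"
    and disc: "r \<le> exp 2 \<or> g * ln r \<le> C2 * a * (\<sigma> / q) * (1 + ln (q / a))"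
    and deg: "g \<le> C3 * A * (q / \<sigma>)"
  shows "g \<le> (8 + 5 * C2 + C3) *
     (a * A + A * peak (q / \<sigma>) + A * peak \<sigma> + a * peak (\<sigma> / q) + a * peak (\<sigma> / sqrt q))"
proof -
  let ?Q = "8 + 5 * C2 + C3"
  have nn: "0 \<le> a * A" "0 \<le> A * peak (q / \<sigma>)" "0 \<le> A * peak \<sigma>" "0 \<le> a * peak (\<sigma> / q)"
    "0 \<le> a * peak (\<sigma> / sqrt q)"
    using assms by (auto intro!: mult_nonneg_nonneg peak_nonneg)
  \<comment> \<open>Each case below bounds \<open>g\<close> by a constant times just one of the five
    nonnegative summands.\<close>
  have close: ?thesis if "g \<le> c * t" "0 \<le> c" "c \<le> ?Q" "0 \<le> t"
    "t \<le> a * A + A * peak (q / \<sigma>) + A * peak \<sigma> + a * peak (\<sigma> / q) + a * peak (\<sigma> / sqrt q)" for c t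
  proof -
    have "c * t \<le> ?Q * (a * A + A * peak (q / \<sigma>) + A * peak \<sigma> + a * peak (\<sigma> / q) + a * peak (\<sigma> / sqrt q))"
      using that C by (intro mult_mono) auto
    with that show ?thesis by linarith
  qed
  have e2: "exp 2 \<le> (8 :: real)"
  proof -
    have "exp (2 :: real) = (exp 1)\<^sup>2" by (simp flip: exp_double)
    also have "\<dots> \<le> 2.8\<^sup>2" using e_less_272 by (intro power_mono) auto
    finally show ?thesis by (simp add: power2_eq_square)
  qed
  consider (small) "r \<le> exp 2" | (ratio) "r \<le> \<sigma>" | (big) "exp 2 < r" "\<sigma> < r" by linarith
  then show ?thesis
  proof cases
    case small
    have "g \<le> 8 * a * A / \<sigma>"
      unfolding g using small e2 assms by (intro divide_right_mono mult_right_mono) auto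
    also have "\<dots> \<le> 8 * a * A / 1"
      using assms by (intro divide_left_mono) auto
    finally have "g \<le> 8 * (a * A)" by simp
    then show ?thesis using nn C by (intro close[of 8 "a * A"]) auto
  next
    case ratio
    have "g = (r / \<sigma>) * (a * A)" by (simp add: g)
    also have "\<dots> \<le> 1 * (a * A)" using ratio s nn by (intro mult_right_mono) auto
    finally show ?thesis using nn C by (intro close[of 1 "a * A"]) auto
  next
    case big
    have lr: "ln r > 2" using big r by (metis exp_less_cancel_iff exp_ln)
    have gb: "g * ln r \<le> C2 * a * (\<sigma> / q) * (1 + ln (q / a))" using disc big by linarith
    have qa: "q / a \<ge> 1" using a q by simp
    then have lqa: "ln (q / a) \<ge> 0" by simp
    show ?thesis
    proof (cases "\<sigma> \<ge> q")
      case True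
      then have "peak (q / \<sigma>) = q / \<sigma>" using s q by (intro peak_eq_self) auto
      then show ?thesis using deg nn C by (intro close[of C3 "A * peak (q / \<sigma>)"]) auto
    next
      case False
      show ?thesis
      \<comment> \<open>If the entropy \<open>1 + ln (q / a)\<close> is at most
        \<open>5 * ln r\<close>, the logarithm cancels from the discrepancy bound. Otherwise
        \<open>r ^ 4 < q / a\<close>; the fourth power is chosen so that, when
        \<open>q / a \<le> q\<^sup>2\<close>, two square roots put \<open>r\<close>, hence also
        \<sigma>, below \<open>sqrt q\<close>.\<close>
      proof (cases "ln (q / a) \<le> 4 * ln r")
        case True
        have "g * ln r \<le> C2 * a * (\<sigma> / q) * (5 * ln r)"
          using True lr assms by (intro order_trans[OF gb] mult_left_mono) auto
        then have "g * ln r \<le> (C2 * a * (\<sigma> / q) * 5) * ln r" by (simp add: algebra_simps)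
        then have "g \<le> C2 * a * (\<sigma> / q) * 5" using lr by (subst (asm) mult_le_cancel_right) auto
        moreover have "peak (\<sigma> / q) = \<sigma> / q" using False s q by (intro peak_eq_self) auto
        ultimately show ?thesis using nn C by (intro close[of "5 * C2" "a * peak (\<sigma> / q)"]) (auto simp: ac_simps)
      next
        case F2: False
        have "ln (r ^ 4) < ln (q / a)" using F2 r by (simp add: ln_realpow)
        then have r4: "r ^ 4 < q / a" using r a q by (subst (asm) ln_less_cancel_iff) auto
        show ?thesis
        proof (cases "q * a \<ge> 1")
          case True
          have "q / a \<le> q\<^sup>2" using True a q by (simp add: field_simps power2_eq_square)
          with r4 have "(r\<^sup>2)\<^sup>2 < q\<^sup>2" by simp
          then have "r\<^sup>2 < q" by (rule power_less_imp_less_base) (use q in simp)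
          then have rq: "r < sqrt q" by (rule real_less_rsqrt)
          have "ln (q / a) \<le> ln (q\<^sup>2)" using \<open>q / a \<le> q\<^sup>2\<close> q a by (subst ln_le_cancel_iff) auto
          also have "\<dots> = 4 * ln (sqrt q)" using q by (simp add: ln_sqrt ln_realpow)
          also have "\<dots> \<le> 4 * (sqrt q - 1)" using q by (intro mult_left_mono ln_le_minus_one) auto
          finally have l: "1 + ln (q / a) \<le> 4 * sqrt q" by simp
          have "g * 2 \<le> C2 * a * (\<sigma> / q) * (1 + ln (q / a))"
          proof -
            have "g \<ge> 0" unfolding g using assms by simp
            then have "g * 2 \<le> g * ln r" using lr by (intro mult_left_mono) auto
            with gb show ?thesis by linarith
          qed
          also have "\<dots> \<le> C2 * a * (\<sigma> / q) * (4 * sqrt q)"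
            using l assms by (intro mult_left_mono) auto
          also have "\<dots> = 4 * (C2 * (a * (\<sigma> / sqrt q)))"
            using q by (simp add: field_simps)
          finally have "g \<le> 2 * C2 * (a * (\<sigma> / sqrt q))" by simp
          moreover have "peak (\<sigma> / sqrt q) = \<sigma> / sqrt q"
            using rq big s q by (intro peak_eq_self) auto
          ultimately show ?thesis using nn C by (intro close[of "2 * C2" "a * peak (\<sigma> / sqrt q)"]) auto
        next
          case False
          \<comment> \<open>Now \<open>r ^ 4 < q / a < 1 / a\<^sup>2\<close>, so
            \<open>(r * a)\<^sup>2 < a \<le> 4\<close>: the small mass offsets the excess over the
            mean, and \<open>1 / \<sigma>\<close> is the decaying factor.\<close>
          have "q < 1 / a" using False a by (simp add: field_simps)
          then have "q / a < (1 / a)\<^sup>2" using a by (simp add: field_simps power2_eq_square)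
          with r4 have "(r\<^sup>2)\<^sup>2 < (1 / a)\<^sup>2" by simp
          then have "r\<^sup>2 < 1 / a" by (rule power_less_imp_less_base) (use a in simp)
          then have "(r * a)\<^sup>2 < a" using a by (simp add: field_simps power2_eq_square)
          then have "(r * a)\<^sup>2 \<le> 2\<^sup>2" using a by simp
          then have "r * a \<le> 2" by (rule power2_le_imp_le) simp
          then have "g \<le> 2 * A / \<sigma>"
            unfolding g using assms by (intro divide_right_mono mult_right_mono) auto
          then show ?thesis using nn C s
            by (intro close[of 2 "A * peak \<sigma>"]) (auto simp: peak_eq_inverse)
        qed
      qed
    qed
  qed
qed

subsection \<open>Tensors indexed by projections\<close>

text \<open>The unfolded tensor keeps the original multi-indices \<Omega>; joint injectivity of the
  projections identifies them with a part of the product of the \<open>I j\<close>. Sides of size at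
  most \<open>N\<close> leave room for a shorter last block.\<close>

locale jointly_injective_projections =
  fixes \<Omega> :: "'w set" and J :: "'j set" and I :: "'j \<Rightarrow> 'a set" and \<pi> :: "'j \<Rightarrow> 'w \<Rightarrow> 'a"
    and N :: nat and p :: real
  assumes finite_\<Omega>: "finite \<Omega>" and finite_J: "finite J" and finite_I: "\<And>j. j \<in> J \<Longrightarrow> finite (I j)"
    and card_J: "2 \<le> card J" and card_I: "\<And>j. j \<in> J \<Longrightarrow> card (I j) \<le> N"
    and proj: "\<And>w j. w \<in> \<Omega> \<Longrightarrow> j \<in> J \<Longrightarrow> \<pi> j w \<in> I j"
    and proj_inj: "\<And>w w'. w \<in> \<Omega> \<Longrightarrow> w' \<in> \<Omega> \<Longrightarrow> (\<And>j. j \<in> J \<Longrightarrow> \<pi> j w = \<pi> j w') \<Longrightarrow> w = w'"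
    and N_ge_2: "2 \<le> N" and p_pos: "0 < p" and p_le_1: "p \<le> 1"
begin

definition \<tau> :: real where "\<tau> = sqrt (p / N)"

definition box :: "('j \<Rightarrow> 'a set) \<Rightarrow> 'w set" where
  "box D = {w \<in> \<Omega>. \<forall>j\<in>J. \<pi> j w \<in> D j}"

definition form :: "('w \<Rightarrow> real) \<Rightarrow> ('j \<Rightarrow> 'a \<Rightarrow> real) \<Rightarrow> real" where
  "form R y = (\<Sum>w\<in>\<Omega>. R w * (\<Prod>j\<in>J. y j (\<pi> j w)))"

lemma N_pos: "0 < N" "real N > 0"
  using N_ge_2 by auto

lemma tau_pos: "\<tau> > 0"
  using p_pos N_pos by (simp add: \<tau>_def)

lemma p_eq: "p = N * \<tau>\<^sup>2"
  using p_pos N_pos by (simp add: \<tau>_def)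

text \<open>Joint injectivity embeds \<Omega> into the product of the \<open>I j\<close>. For
  nonnegative terms the sum over the whole product is an upper bound, and it factorises.\<close>

lemma sum_prod_proj_le:
  fixes f :: "'j \<Rightarrow> 'a \<Rightarrow> real"
  assumes "\<And>j u. f j u \<ge> 0"
  shows "(\<Sum>w\<in>\<Omega>. \<Prod>j\<in>J. f j (\<pi> j w)) \<le> (\<Prod>j\<in>J. \<Sum>u\<in>I j. f j u)"
proof -
  let ?F = "\<lambda>w. \<lambda>j\<in>J. \<pi> j w"
  have inj: "inj_on ?F \<Omega>"
  proof (rule inj_onI)
    fix w w' assume w: "w \<in> \<Omega>" "w' \<in> \<Omega>" and eq: "?F w = ?F w'"
    have "\<pi> j w = \<pi> j w'" if "j \<in> J" for j
      using fun_cong[OF eq, of j] that by simp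
    with w show "w = w'" by (rule proj_inj)
  qed
  have "(\<Sum>w\<in>\<Omega>. \<Prod>j\<in>J. f j (\<pi> j w)) = (\<Sum>v\<in>?F ` \<Omega>. \<Prod>j\<in>J. f j (v j))"
    by (subst sum.reindex[OF inj]) simp
  also have "\<dots> \<le> (\<Sum>v\<in>PiE J I. \<Prod>j\<in>J. f j (v j))"
    using assms finite_J finite_I proj by (intro sum_mono2 finite_PiE) (auto intro!: prod_nonneg)
  also have "\<dots> = (\<Prod>j\<in>J. \<Sum>u\<in>I j. f j u)"
    by (subst prod_sum_PiE) (auto simp: finite_J finite_I)
  finally show ?thesis .
qed

lemma card_box_le:
  assumes "\<And>j. j \<in> J \<Longrightarrow> D j \<subseteq> I j"
  shows "real (card (box D)) \<le> (\<Prod>j\<in>J. real (card (D j)))"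
proof -
  have "real (card (box D)) = (\<Sum>w\<in>\<Omega>. \<Prod>j\<in>J. of_bool (\<pi> j w \<in> D j))"
  proof -
    have "(\<Sum>w\<in>\<Omega>. \<Prod>j\<in>J. of_bool (\<pi> j w \<in> D j) :: real) = (\<Sum>w\<in>\<Omega>. if w \<in> box D then 1 else 0)"
      by (rule sum.cong) (auto simp: box_def finite_J)
    then show ?thesis
      using finite_\<Omega> by (simp add: sum.If_cases box_def Int_def conj_ac)
  qed
  also have "\<dots> \<le> (\<Prod>j\<in>J. \<Sum>u\<in>I j. of_bool (u \<in> D j))"
    by (rule sum_prod_proj_le) simp
  also have "\<dots> = (\<Prod>j\<in>J. real (card (D j)))"
  proof (rule prod.cong)
    fix j assume j: "j \<in> J"
    then have "I j \<inter> D j = D j" using assms by auto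
    then show "(\<Sum>u\<in>I j. of_bool (u \<in> D j)) = real (card (D j))"
      using finite_I[OF j] by (simp add: of_bool_def sum.If_cases Int_def)
  qed simp
  finally show ?thesis .
qed

lemma card_\<Omega>_le: "card \<Omega> \<le> N ^ card J"
proof -
  have "box I = \<Omega>" using proj by (auto simp: box_def)
  then have "real (card \<Omega>) \<le> (\<Prod>j\<in>J. real (card (I j)))" using card_box_le[of I] by simp
  also have "\<dots> \<le> (\<Prod>j\<in>J. real N)" by (intro prod_mono) (auto intro: card_I)
  finally have "real (card \<Omega>) \<le> real (N ^ card J)" by simp
  then show ?thesis by (simp only: of_nat_le_iff)
qed

lemma form_fun_upd:
  assumes "i \<in> J"
  shows "form R (y(i := z)) =
    (\<Sum>u\<in>I i. (\<Sum>w\<in>{w\<in>\<Omega>. \<pi> i w = u}. R w * (\<Prod>j\<in>J - {i}. y j (\<pi> j w))) * z u)"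
proof -
  have "form R (y(i := z)) = (\<Sum>w\<in>\<Omega>. R w * (\<Prod>j\<in>J - {i}. y j (\<pi> j w)) * z (\<pi> i w))"
    unfolding form_def
  proof (rule sum.cong)
    fix w assume "w \<in> \<Omega>"
    have "(\<Prod>j\<in>J. (y(i := z)) j (\<pi> j w)) = z (\<pi> i w) * (\<Prod>j\<in>J - {i}. (y(i := z)) j (\<pi> j w))"
      by (subst prod.remove[OF finite_J assms]) simp
    also have "(\<Prod>j\<in>J - {i}. (y(i := z)) j (\<pi> j w)) = (\<Prod>j\<in>J - {i}. y j (\<pi> j w))"
      by (rule prod.cong) auto
    finally show "R w * (\<Prod>j\<in>J. (y(i := z)) j (\<pi> j w)) = R w * (\<Prod>j\<in>J - {i}. y j (\<pi> j w)) * z (\<pi> i w)"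
      by simp
  qed simp
  also have "\<dots> = (\<Sum>u\<in>I i. \<Sum>w\<in>{w\<in>\<Omega>. \<pi> i w = u}. R w * (\<Prod>j\<in>J - {i}. y j (\<pi> j w)) * z (\<pi> i w))"
    using finite_\<Omega> finite_I[OF assms] proj assms by (intro sum.group[symmetric]) auto
  also have "\<dots> = (\<Sum>u\<in>I i. (\<Sum>w\<in>{w\<in>\<Omega>. \<pi> i w = u}. R w * (\<Prod>j\<in>J - {i}. y j (\<pi> j w))) * z u)"
    by (intro sum.cong) (auto simp: sum_distrib_right)
  finally show ?thesis .
qed

lemma form_cong: "(\<And>j. j \<in> J \<Longrightarrow> y j = y' j) \<Longrightarrow> form R y = form R y'"
  unfolding form_def by (intro sum.cong prod.cong arg_cong2[where f = "(*)"]) auto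

text \<open>The arguments are replaced by net points one slot at a time, each slot costing a factor
  2. In the induction \<open>S\<close> is the set of slots that still hold arbitrary
  vectors.\<close>

lemma form_le_net:
  assumes net: "\<And>z. z \<in> PiE J (\<lambda>j. ball_net (I j) N) \<Longrightarrow> \<bar>form R z\<bar> \<le> b"
    and y: "\<And>j. j \<in> J \<Longrightarrow> (\<Sum>u\<in>I j. (y j u)\<^sup>2) \<le> 1"
  shows "\<bar>form R y\<bar> \<le> 2 ^ card J * b"
proof -
  have "\<bar>form R y\<bar> \<le> 2 ^ card S * b"
    if "finite S" "S \<subseteq> J" "\<And>j. j \<in> J - S \<Longrightarrow> y j \<in> ball_net (I j) N"
      "\<And>j. j \<in> S \<Longrightarrow> (\<Sum>u\<in>I j. (y j u)\<^sup>2) \<le> 1" for S y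
    using that
  proof (induction S arbitrary: y rule: finite_induct)
    case empty
    have "form R y = form R (restrict y J)" by (rule form_cong) simp
    then show ?case using net[of "restrict y J"] empty by auto
  next
    case (insert i S)
    then have i: "i \<in> J" by simp
    define G where "G = (\<lambda>u. \<Sum>w\<in>{w\<in>\<Omega>. \<pi> i w = u}. R w * (\<Prod>j\<in>J - {i}. y j (\<pi> j w)))"
    have lin: "form R (y(i := z)) = (\<Sum>u\<in>I i. G u * z u)" for z
      unfolding G_def by (rule form_fun_upd[OF i])
    have "\<bar>\<Sum>u\<in>I i. G u * y i u\<bar> \<le> 2 * (2 ^ card S * b)"
    proof (rule linear_form_le_twice_net[OF finite_I[OF i] card_I[OF i] N_pos(1)])
      show "(\<Sum>u\<in>I i. (y i u)\<^sup>2) \<le> 1" using insert.prems by simp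
      fix z assume "z \<in> ball_net (I i) N"
      then have "\<bar>form R (y(i := z))\<bar> \<le> 2 ^ card S * b"
        using insert by (intro insert.IH) auto
      then show "\<bar>\<Sum>u\<in>I i. G u * z u\<bar> \<le> 2 ^ card S * b" by (simp add: lin)
    qed
    then show ?case using lin[of "y i"] insert.hyps by simp
  qed
  from this[OF finite_J subset_refl] y show ?thesis by simp
qed

text \<open>A fibre is named by its direction \<open>j\<close> and a point \<open>w0\<close> on it,
  so a union bound over all fibres ranges over \<open>J \<times> \<Omega>\<close>.\<close>

definition degree_bounded :: "real \<Rightarrow> ('w \<Rightarrow> bool) \<Rightarrow> bool" where
  "degree_bounded C B \<longleftrightarrow> (\<forall>j\<in>J. \<forall>w0\<in>\<Omega>.
     real (card {w\<in>\<Omega>. (\<forall>l\<in>J - {j}. \<pi> l w = \<pi> l w0) \<and> B w}) \<le> C * real N * p)"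

text \<open>\<open>M * (1 + ln (N / M))\<close> bounds the logarithm of the number of subsets of
  size at most \<open>M\<close> of an \<open>N\<close>-element set. One \<open>M\<close> dominates
  all sides, so only the largest side of the box enters.\<close>

definition discrepancy_bounded :: "real \<Rightarrow> ('w \<Rightarrow> bool) \<Rightarrow> bool" where
  "discrepancy_bounded C B \<longleftrightarrow> (\<forall>M\<in>{1..N}. \<forall>D \<in> PiE J (\<lambda>j. {A. A \<subseteq> I j \<and> A \<noteq> {} \<and> card A \<le> M}).
     let e = real (card {w \<in> box D. B w}); \<mu> = p * (\<Prod>j\<in>J. real (card (D j)))
     in e \<le> exp 2 * \<mu> \<or> e * ln (e / \<mu>) \<le> C * real M * (1 + ln (real N / real M)))"

text \<open>Group the sampled entries of the box by their coordinates other than \<open>j\<close>: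
  each group lies in one fibre, and the groups number at most the product of the other side
  lengths.\<close>

lemma degree_boundedD:
  assumes "degree_bounded C B" "C \<ge> 0" "j \<in> J" "\<And>l. l \<in> J \<Longrightarrow> D l \<subseteq> I l"
  shows "real (card {w \<in> box D. B w}) \<le> C * real N * p * (\<Prod>l\<in>J - {j}. real (card (D l)))"
proof -
  let ?X = "{w \<in> box D. B w}" and ?F = "\<lambda>w. \<lambda>l\<in>J - {j}. \<pi> l w"
  have fin: "finite ?X" using finite_\<Omega> by (auto simp: box_def)
  have finD: "finite (D l)" if "l \<in> J" for l using assms(4)[OF that] finite_I[OF that] by (rule finite_subset)
  have "real (card ?X) = (\<Sum>w\<in>?X. 1)" by simp
  also have "\<dots> = (\<Sum>v\<in>?F ` ?X. \<Sum>w\<in>{w\<in>?X. ?F w = v}. 1)"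
    by (rule sum.image_gen[OF fin])
  also have "\<dots> \<le> (\<Sum>v\<in>?F ` ?X. C * N * p)"
  proof (rule sum_mono)
    fix v assume "v \<in> ?F ` ?X"
    then obtain w0 where "w0 \<in> ?X" and v: "v = ?F w0" by (rule imageE)
    then have w0: "w0 \<in> \<Omega>" by (simp add: box_def)
    have "{w\<in>?X. ?F w = v} \<subseteq> {w\<in>\<Omega>. (\<forall>l\<in>J - {j}. \<pi> l w = \<pi> l w0) \<and> B w}"
    proof
      fix w assume w: "w \<in> {w\<in>?X. ?F w = v}"
      then have "?F w = v" by blast
      then have eq: "?F w = ?F w0" by (simp only: v)
      have "\<pi> l w = \<pi> l w0" if "l \<in> J - {j}" for l
        using fun_cong[OF eq, of l] that by simp
      moreover have "w \<in> \<Omega>" "B w" using w by (simp_all add: box_def)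
      ultimately show "w \<in> {w\<in>\<Omega>. (\<forall>l\<in>J - {j}. \<pi> l w = \<pi> l w0) \<and> B w}" by blast
    qed
    then have "card {w\<in>?X. ?F w = v} \<le> card {w\<in>\<Omega>. (\<forall>l\<in>J - {j}. \<pi> l w = \<pi> l w0) \<and> B w}"
      using finite_\<Omega> by (intro card_mono) auto
    also have "real \<dots> \<le> C * real N * p"
      using assms(1,3) w0 unfolding degree_bounded_def by blast
    finally show "(\<Sum>w\<in>{w\<in>?X. ?F w = v}. 1) \<le> C * real N * p" by simp
  qed
  also have "\<dots> = C * N * p * real (card (?F ` ?X))" by simp
  also have "\<dots> \<le> C * real N * p * (\<Prod>l\<in>J - {j}. real (card (D l)))"
  proof (rule mult_left_mono)
    have "card (?F ` ?X) \<le> card (PiE (J - {j}) D)"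
    proof (rule card_mono)
      show "finite (PiE (J - {j}) D)" using finD finite_J by (intro finite_PiE) simp_all
      show "?F ` ?X \<subseteq> PiE (J - {j}) D"
      proof (rule image_subsetI, rule restrict_PiE_iff[THEN iffD2], rule ballI)
        fix w l assume "w \<in> ?X" "l \<in> J - {j}"
        then show "\<pi> l w \<in> D l" by (simp add: box_def)
      qed
    qed
    also have "\<dots> = (\<Prod>l\<in>J - {j}. card (D l))" using finite_J by (simp add: card_PiE)
    finally have "real (card (?F ` ?X)) \<le> real (\<Prod>l\<in>J - {j}. card (D l))" by (simp only: of_nat_le_iff)
    then show "real (card (?F ` ?X)) \<le> (\<Prod>l\<in>J - {j}. real (card (D l)))" by simp
    show "C * real N * p \<ge> 0" using assms(2) p_pos by simp
  qed
  finally show ?thesis .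
qed

end

subsection \<open>Heavy entries\<close>

definition dyadic_level :: "('a \<Rightarrow> real) \<Rightarrow> 'a set \<Rightarrow> nat \<Rightarrow> 'a set" where
  "dyadic_level f U s = {u \<in> U. (1/2) ^ Suc s < \<bar>f u\<bar> \<and> \<bar>f u\<bar> \<le> (1/2) ^ s}"

definition dyadic_exponent :: "real \<Rightarrow> nat" where
  "dyadic_exponent x = (LEAST s. (1/2) ^ Suc s < x)"

lemma dyadic_exponent:
  assumes "0 < x" "x \<le> 1"
  shows "(1/2) ^ Suc (dyadic_exponent x) < x" "x \<le> (1/2) ^ dyadic_exponent x"
proof -
  obtain n where "(1/2) ^ n < x" using real_arch_pow_inv[of x "1/2"] assms by auto
  then have "(1/2) ^ Suc n < x" using assms by simp
  then show "(1/2) ^ Suc (dyadic_exponent x) < x" unfolding dyadic_exponent_def by (rule LeastI)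
  show "x \<le> (1/2) ^ dyadic_exponent x"
  proof (cases "dyadic_exponent x")
    case (Suc s)
    then show ?thesis using not_less_Least[of s "\<lambda>s. (1/2) ^ Suc s < x"]
      by (simp add: dyadic_exponent_def)
  qed (use assms in simp)
qed

lemma dyadic_level_disjoint:
  assumes "s \<noteq> t"
  shows "dyadic_level f U s \<inter> dyadic_level f U t = {}"
proof -
  have "\<not> ((1/2 :: real) ^ Suc a < x \<and> x \<le> (1/2) ^ b)" if "a < b" for a b x
  proof -
    have "(1/2 :: real) ^ b \<le> (1/2) ^ Suc a" using that by (intro power_decreasing) auto
    then show ?thesis by linarith
  qed
  with assms show ?thesis
    unfolding dyadic_level_def by (auto simp: neq_iff simp del: power_Suc; blast)
qed

text \<open>Up to a factor 4 this is the squared norm carried by the level, so the masses of a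
  vector in the unit ball have bounded sum.\<close>

definition level_mass :: "('a \<Rightarrow> real) \<Rightarrow> 'a set \<Rightarrow> nat \<Rightarrow> real" where
  "level_mass f U s = real (card (dyadic_level f U s)) * (1/4) ^ s"

lemma level_mass_nonneg: "level_mass f U s \<ge> 0"
  by (simp add: level_mass_def)

lemma sum_level_mass_le:
  assumes "finite U" "(\<Sum>u\<in>U. (f u)\<^sup>2) \<le> 1"
  shows "(\<Sum>s<S. level_mass f U s) \<le> 4"
proof -
  have fin: "finite (dyadic_level f U s)" for s using assms by (simp add: dyadic_level_def)
  have "(\<Sum>s<S. level_mass f U s) = (\<Sum>s<S. \<Sum>u\<in>dyadic_level f U s. (1/4) ^ s)"
    by (simp add: level_mass_def)
  also have "\<dots> \<le> (\<Sum>s<S. \<Sum>u\<in>dyadic_level f U s. 4 * (f u)\<^sup>2)"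
  proof (intro sum_mono)
    fix s u assume "u \<in> dyadic_level f U s"
    then have "((1/2) ^ Suc s)\<^sup>2 \<le> \<bar>f u\<bar>\<^sup>2"
      unfolding dyadic_level_def by (intro power_mono) auto
    moreover have "((1/2 :: real) ^ Suc s)\<^sup>2 = (1/4) ^ Suc s"
      by (simp only: power2_eq_square power_mult_distrib[symmetric]) simp
    ultimately show "(1/4) ^ s \<le> 4 * (f u)\<^sup>2" by simp
  qed
  also have "\<dots> = (\<Sum>u\<in>(\<Union>s<S. dyadic_level f U s). 4 * (f u)\<^sup>2)"
    by (rule sum.UNION_disjoint[symmetric]) (auto simp: fin dyadic_level_disjoint)
  also have "\<dots> \<le> (\<Sum>u\<in>U. 4 * (f u)\<^sup>2)"
    using assms by (intro sum_mono2) (auto simp: dyadic_level_def)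
  also have "\<dots> \<le> 4" using assms by (simp flip: sum_distrib_left)
  finally show ?thesis .
qed

lemma level_mass_le:
  assumes "finite U" "(\<Sum>u\<in>U. (f u)\<^sup>2) \<le> 1"
  shows "level_mass f U s \<le> 4"
proof -
  have "level_mass f U s \<le> (\<Sum>s<Suc s. level_mass f U s)"
    by (rule member_le_sum) (auto simp: level_mass_nonneg)
  with sum_level_mass_le[OF assms, of "Suc s"] show ?thesis by linarith
qed

section \<open>Heavy sampled entries over tuples of level sets\<close>

context jointly_injective_projections begin

context
  fixes y :: "'j \<Rightarrow> 'a \<Rightarrow> real" and B :: "'w \<Rightarrow> bool" and C2 C3 :: real
  assumes y: "\<And>j. j \<in> J \<Longrightarrow> (\<Sum>u\<in>I j. (y j u)\<^sup>2) \<le> 1"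
    and C: "C2 \<ge> 0" "C3 \<ge> 0"
    and deg: "degree_bounded C3 B" and disc: "discrepancy_bounded C2 B"
begin

abbreviation L where "L j s \<equiv> dyadic_level (y j) (I j) s"
abbreviation \<alpha> where "\<alpha> j s \<equiv> level_mass (y j) (I j) s"
abbreviation q where "q x \<equiv> real N * (1/4) ^ x"

text \<open>The upper bound for the products on a tuple of levels, in units of \<tau>; it exceeds 1
  on every tuple that contains a heavy entry.\<close>

definition weight :: "('j \<Rightarrow> nat) \<Rightarrow> real" where
  "weight s = (1/2) ^ (\<Sum>l\<in>J. s l) / \<tau>"

definition level_count :: "('j \<Rightarrow> nat) \<Rightarrow> real" where
  "level_count s = real (card {w \<in> box (\<lambda>j. L j (s j)). B w})"

text \<open>The five terms of \<open>heavy_case_analysis\<close>, meant for a coordinate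
  \<open>j\<close> whose level set is largest. The first three carry the masses of all other
  coordinates; the last two stem from the entropic bound and carry only the mass of
  \<open>j\<close>.\<close>

definition peak_sum :: "('j \<Rightarrow> nat) \<Rightarrow> 'j \<Rightarrow> real" where
  "peak_sum s j = \<alpha> j (s j) * (\<Prod>l\<in>J - {j}. \<alpha> l (s l))
     + (\<Prod>l\<in>J - {j}. \<alpha> l (s l)) * peak (q (s j) / weight s)
     + (\<Prod>l\<in>J - {j}. \<alpha> l (s l)) * peak (weight s)
     + \<alpha> j (s j) * peak (weight s / q (s j)) + \<alpha> j (s j) * peak (weight s / sqrt (q (s j)))"

lemma weight_pos: "weight s > 0"
  using tau_pos by (simp add: weight_def)

lemma peak_sum_nonneg: "peak_sum s j \<ge> 0"
  unfolding peak_sum_def using weight_pos[of s]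
  by (intro add_nonneg_nonneg mult_nonneg_nonneg peak_nonneg prod_nonneg) (auto simp: level_mass_nonneg)

lemma prod_level_mass:
  assumes "A \<subseteq> J"
  shows "(\<Prod>l\<in>A. \<alpha> l (s l)) = (\<Prod>l\<in>A. real (card (L l (s l)))) * ((1/2) ^ (\<Sum>l\<in>A. s l))\<^sup>2"
proof -
  have "(\<Prod>l\<in>A. (1/4 :: real) ^ s l) = ((1/2) ^ (\<Sum>l\<in>A. s l))\<^sup>2"
    by (simp add: power_sum[symmetric] power2_eq_square flip: power_mult_distrib)
  then show ?thesis by (simp add: level_mass_def prod.distrib)
qed

text \<open>Taking \<open>j\<close> with the largest level set allows the discrepancy condition to
  be used with \<open>M\<close> the size of that set, and the degree condition along fibres in
  direction \<open>j\<close>.\<close>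

lemma level_contribution_le:
  assumes w: "weight s > 1"
  shows "\<exists>j\<in>J. level_count s * weight s / N \<le> (8 + 5 * C2 + C3) * peak_sum s j"
proof (cases "level_count s = 0")
  case True
  moreover have "J \<noteq> {}" using card_J by auto
  ultimately show ?thesis using C peak_sum_nonneg[of s] by (auto intro!: mult_nonneg_nonneg)
next
  case False
  define e where "e = level_count s"
  have e: "e > 0" using False by (simp add: e_def level_count_def)
  let ?n = "\<lambda>j. card (L j (s j))"
  have finL: "finite (L j (s j))" if "j \<in> J" for j using finite_I[OF that] by (simp add: dyadic_level_def)
  have LI: "L j (s j) \<subseteq> I j" for j by (auto simp: dyadic_level_def)
  have ne: "L j (s j) \<noteq> {}" if "j \<in> J" for j
  proof
    assume "L j (s j) = {}"
    then have "box (\<lambda>j. L j (s j)) = {}" using that by (auto simp: box_def)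
    then show False using e by (simp add: e_def level_count_def)
  qed
  have npos: "?n j > 0" if "j \<in> J" for j using finL ne that by (simp add: card_gt_0_iff)
  have "J \<noteq> {}" using card_J by auto
  then have "Max (?n ` J) \<in> ?n ` J" using finite_J by (intro Max_in) auto
  then obtain j where jM: "Max (?n ` J) = ?n j" and jJ: "j \<in> J" by (rule imageE)
  have jmax: "?n l \<le> ?n j" if "l \<in> J" for l
    unfolding jM[symmetric] using that finite_J by (intro Max_ge) auto
  note j = jJ jmax
  define n where "n = ?n j"
  define Pn where "Pn = (\<Prod>l\<in>J. real (?n l))"
  define Pj where "Pj = (\<Prod>l\<in>J - {j}. real (?n l))"
  define Aj where "Aj = (\<Prod>l\<in>J - {j}. \<alpha> l (s l))"
  define \<sigma> where "\<sigma> = weight s"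
  define \<mu> where "\<mu> = p * Pn"
  have n0: "n > 0" using npos j by (simp add: n_def)
  have nN: "n \<le> N" unfolding n_def
    using card_mono[OF finite_I[OF j(1)] LI] card_I[OF j(1)] by linarith
  have Pn: "Pn = n * Pj" unfolding Pn_def Pj_def n_def by (rule prod.remove[OF finite_J j(1)])
  have Pj0: "Pj > 0" unfolding Pj_def using npos by (intro prod_pos) auto
  have mu0: "\<mu> > 0" using Pj0 n0 p_pos by (simp add: \<mu>_def Pn)
  have \<sigma>1: "\<sigma> > 1" using w by (simp add: \<sigma>_def)
  have W: "(1/2) ^ (\<Sum>l\<in>J. s l) = \<sigma> * \<tau>" using tau_pos by (simp add: \<sigma>_def weight_def)
  have Wj: "\<sigma> * \<tau> = (1/2) ^ s j * (1/2) ^ (\<Sum>l\<in>J - {j}. s l)"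
    by (simp add: W[symmetric] power_add[symmetric] sum.remove[OF finite_J j(1)])
  have Aj: "Aj = Pj * ((1/2) ^ (\<Sum>l\<in>J - {j}. s l))\<^sup>2"
    unfolding Aj_def Pj_def by (rule prod_level_mass) auto
  have quarter: "(1/4 :: real) ^ s j = ((1/2) ^ s j)\<^sup>2"
    by (simp add: power2_eq_square flip: power_mult_distrib)
  have Ajq: "Aj * (1/4) ^ s j = Pj * (\<sigma> * \<tau>)\<^sup>2"
    unfolding Aj Wj quarter by (simp add: power_mult_distrib)
  have a: "\<alpha> j (s j) = n * (1/4) ^ s j" by (simp add: level_mass_def n_def)
  show ?thesis
  proof (rule bexI[OF _ j(1)])
    show "level_count s * weight s / N \<le> (8 + 5 * C2 + C3) * peak_sum s j"
      unfolding peak_sum_def e_def[symmetric] \<sigma>_def[symmetric] Aj_def[symmetric]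
    proof (rule heavy_case_analysis)
      show "0 < \<alpha> j (s j)" using n0 by (simp add: a)
      show "\<alpha> j (s j) \<le> 4" using finite_I[OF j(1)] y[OF j(1)] by (rule level_mass_le)
      show "0 \<le> Aj" unfolding Aj_def by (intro prod_nonneg) (simp add: level_mass_nonneg)
      show "1 < \<sigma>" by fact
      show "\<alpha> j (s j) \<le> q (s j)" unfolding a using nN by (intro mult_right_mono) auto
      show "0 < q (s j)" using N_pos by simp
      show "0 < e / \<mu>" using e mu0 by simp
      \<comment> \<open>By \<open>p = N * \<tau>\<^sup>2\<close>, masses and expected count are tied
        by \<open>N * (\<alpha> j (s j) * Aj) = \<mu> * \<sigma>\<^sup>2\<close>; this removes
        \<open>p\<close> and \<tau> from the case analysis.\<close>
      show "e * \<sigma> / N = e / \<mu> * \<alpha> j (s j) * Aj / \<sigma>"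
      proof -
        have "\<alpha> j (s j) * Aj = Pn * (\<sigma> * \<tau>)\<^sup>2" using Ajq by (simp add: a Pn ac_simps)
        moreover have "N * \<tau>\<^sup>2 * Pn = \<mu>" by (simp add: \<mu>_def p_eq[symmetric])
        ultimately have "N * (\<alpha> j (s j) * Aj) = \<mu> * \<sigma>\<^sup>2" by (simp add: power_mult_distrib ac_simps)
        then have "\<alpha> j (s j) * Aj = \<mu> * \<sigma>\<^sup>2 / N" using N_pos by (simp add: field_simps)
        then have "e / \<mu> * \<alpha> j (s j) * Aj / \<sigma> = e / \<mu> * (\<mu> * \<sigma>\<^sup>2 / N) / \<sigma>" by (simp add: mult.assoc)
        then show ?thesis using mu0 \<sigma>1 by (simp add: power2_eq_square)
      qed
      show "C2 \<ge> 0" "C3 \<ge> 0" by fact+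
      show "e / \<mu> \<le> exp 2 \<or> e * \<sigma> / N * ln (e / \<mu>)
          \<le> C2 * \<alpha> j (s j) * (\<sigma> / q (s j)) * (1 + ln (q (s j) / \<alpha> j (s j)))"
      proof -
        let ?D = "restrict (\<lambda>l. L l (s l)) J"
        have D: "?D \<in> PiE J (\<lambda>l. {A. A \<subseteq> I l \<and> A \<noteq> {} \<and> card A \<le> n})"
          using LI ne j by (auto simp: n_def)
        have M: "n \<in> {1..N}" using n0 nN by simp
        have box: "box ?D = box (\<lambda>l. L l (s l))" by (auto simp: box_def)
        have "p * (\<Prod>l\<in>J. real (card (?D l))) = \<mu>" by (simp add: \<mu>_def Pn_def)
        then have "e \<le> exp 2 * \<mu> \<or> e * ln (e / \<mu>) \<le> C2 * real n * (1 + ln (real N / real n))"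
          using disc[unfolded discrepancy_bounded_def, rule_format, OF M D]
          unfolding Let_def box e_def level_count_def by simp
        then show ?thesis
        proof
          assume "e \<le> exp 2 * \<mu>"
          then show ?thesis using mu0 by (simp add: field_simps)
        next
          assume "e * ln (e / \<mu>) \<le> C2 * real n * (1 + ln (real N / real n))"
          then have "e * ln (e / \<mu>) * (\<sigma> / N) \<le> C2 * real n * (1 + ln (real N / real n)) * (\<sigma> / N)"
            using \<sigma>1 by (intro mult_right_mono) auto
          then show ?thesis by (simp add: a ac_simps)
        qed
      qed
      show "e * \<sigma> / N \<le> C3 * Aj * (q (s j) / \<sigma>)"
      proof -
        have "e \<le> C3 * real N * p * Pj"
          unfolding e_def level_count_def Pj_def by (rule degree_boundedD[OF deg C(2) j(1) LI])
        then have "e * (\<sigma> / N) \<le> C3 * real N * p * Pj * (\<sigma> / N)"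
          using \<sigma>1 by (intro mult_right_mono) auto
        also have "\<dots> = C3 * p * Pj * \<sigma>" using N_pos by simp
        also have "\<dots> = C3 * (N * \<tau>\<^sup>2) * Pj * \<sigma>" by (simp only: p_eq[symmetric])
        also have "\<dots> = C3 * (N * (Pj * (\<sigma> * \<tau>)\<^sup>2)) / \<sigma>"
          using \<sigma>1 by (simp add: power2_eq_square)
        also have "\<dots> = C3 * Aj * (q (s j) / \<sigma>)" by (simp add: Ajq[symmetric])
        finally show ?thesis by simp
      qed
    qed
  qed
qed

text \<open>In the first three terms masses sum the other coordinates to a constant, and
  \<open>j\<close> is summed by its mass or geometrically. In the last two the mass takes care of
  \<open>j\<close>, decay takes care of one further coordinate \<open>i\<close>, and the remaining
  \<open>card J - 2\<close> run freely over \<open>S\<close> levels.\<close>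

lemma sum_peak_sum_le:
  assumes j: "j \<in> J" and S: "S \<ge> 1"
  shows "(\<Sum>s\<in>J \<rightarrow>\<^sub>E {..<S}. peak_sum s j) \<le> 5 * 4 ^ card J * real S ^ (card J - 2)"
proof -
  let ?P = "J \<rightarrow>\<^sub>E {..<S}"
  have \<alpha>4: "(\<Sum>x<S. \<alpha> l x) \<le> 4" if "l \<in> J" for l
    using finite_I[OF that] y[OF that] by (rule sum_level_mass_le)
  have \<alpha>0: "(\<Sum>x<S. \<alpha> l x) \<ge> 0" for l by (intro sum_nonneg) (simp add: level_mass_nonneg)
  have \<alpha>prod: "(\<Prod>l\<in>A. \<Sum>x<S. \<alpha> l x) \<le> 4 ^ card A" if "A \<subseteq> J" for A
    using prod_mono[of A "\<lambda>l. \<Sum>x<S. \<alpha> l x" "\<lambda>_. 4"] \<alpha>4 \<alpha>0 that by auto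
  have cJ: "card (J - {j}) = card J - 1" using j by simp
  have four: "4 * 4 ^ (card J - 1) = (4 :: real) ^ card J"
    using card_J by (simp flip: power_Suc)
  have split: "weight s = (1/2) ^ (\<Sum>l\<in>J - {i}. s l) / \<tau> * (1/2) ^ s i" if "i \<in> J" for s i
    unfolding weight_def by (subst sum.remove[OF finite_J that]) (simp add: power_add)
  have upd: "(\<Sum>l\<in>J - {i}. (s(i := x)) l) = (\<Sum>l\<in>J - {i}. s l)" for s :: "'j \<Rightarrow> nat" and i x
    by (intro sum.cong) auto
  have bnd: "(\<Sum>s\<in>?P. (\<Prod>l\<in>J - {j}. \<alpha> l (s l)) * peak (h s * (1/2) ^ s j)) \<le> 4 ^ card J"
    if "\<And>s. h s > 0" "\<And>s x. h (s(j := x)) = h s" for h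
  proof -
    have "(\<Sum>s\<in>?P. (\<Prod>l\<in>J - {j}. \<alpha> l (s l)) * peak (h s * (1/2) ^ s j))
        \<le> 4 * (\<Prod>l\<in>J - {j}. \<Sum>x<S. \<alpha> l x)"
      using finite_J j level_mass_nonneg that by (rule sum_PiE_peak_le)
    with \<alpha>prod[of "J - {j}"] four cJ show ?thesis by auto
  qed
  have T1: "(\<Sum>s\<in>?P. \<alpha> j (s j) * (\<Prod>l\<in>J - {j}. \<alpha> l (s l))) \<le> 4 ^ card J"
  proof -
    have "(\<Sum>s\<in>?P. \<alpha> j (s j) * (\<Prod>l\<in>J - {j}. \<alpha> l (s l))) = (\<Sum>s\<in>?P. \<Prod>l\<in>J. \<alpha> l (s l))"
      by (intro sum.cong refl prod.remove[OF finite_J j, symmetric])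
    also have "\<dots> = (\<Prod>l\<in>J. \<Sum>x<S. \<alpha> l x)" by (subst prod_sum_PiE) (auto simp: finite_J)
    finally show ?thesis using \<alpha>prod[of J] by simp
  qed
  have T2: "(\<Sum>s\<in>?P. (\<Prod>l\<in>J - {j}. \<alpha> l (s l)) * peak (q (s j) / weight s)) \<le> 4 ^ card J"
  proof -
    \<comment> \<open>In \<open>s j\<close> the numerator falls by factors of 4 and the weight by
      factors of 2, so the quotient still halves at each level.\<close>
    have "q (s j) / weight s = N * \<tau> / (1/2) ^ (\<Sum>l\<in>J - {j}. s l) * (1/2) ^ s j" for s
    proof -
      have "(1/4 :: real) ^ s j = (1/2) ^ s j * (1/2) ^ s j" by (simp flip: power_mult_distrib)
      then show ?thesis using tau_pos unfolding split[OF j] by simp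
    qed
    then show ?thesis using bnd[of "\<lambda>s. N * \<tau> / (1/2) ^ (\<Sum>l\<in>J - {j}. s l)"] tau_pos N_pos upd by simp
  qed
  have T3: "(\<Sum>s\<in>?P. (\<Prod>l\<in>J - {j}. \<alpha> l (s l)) * peak (weight s)) \<le> 4 ^ card J"
    using bnd[of "\<lambda>s. (1/2) ^ (\<Sum>l\<in>J - {j}. s l) / \<tau>"] tau_pos upd unfolding split[OF j] by simp
  obtain i where i: "i \<in> J" "i \<noteq> j"
  proof -
    have "J - {j} \<noteq> {}" using cJ card_J by (metis card.empty Suc_1 diff_is_0_eq not_less_eq_eq order_refl)
    then show thesis using that by blast
  qed
  have cJi: "card (J - {i} - {j}) = card J - 2" using i j by (simp add: card_Diff_subset finite_J)
  \<comment> \<open>The factor \<open>h (s j)\<close> is constant in coordinate \<open>i\<close>, so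
    it joins the scale of the geometric sum over \<open>s i\<close>.\<close>
  have bnd2: "(\<Sum>s\<in>?P. \<alpha> j (s j) * peak (h (s j) * weight s)) \<le> 16 * real S ^ (card J - 2)"
    if h: "\<And>x. h x > 0" for h
  proof -
    let ?b = "\<lambda>l x. if l = j then \<alpha> j x else 1"
    have b: "(\<Prod>l\<in>J - {i}. ?b l (s l)) = \<alpha> j (s j)" for s
      using i j finite_J by (simp add: prod.remove[of "J - {i}" j])
    have "(\<Sum>s\<in>?P. \<alpha> j (s j) * peak (h (s j) * weight s))
       = (\<Sum>s\<in>?P. (\<Prod>l\<in>J - {i}. ?b l (s l)) * peak (h (s j) * ((1/2) ^ (\<Sum>l\<in>J - {i}. s l) / \<tau>) * (1/2) ^ s i))"
      unfolding b split[OF i(1)] by (simp add: mult.assoc)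
    also have "\<dots> \<le> 4 * (\<Prod>l\<in>J - {i}. \<Sum>x<S. ?b l x)"
      using tau_pos h i upd by (intro sum_PiE_peak_le finite_J) (auto simp: level_mass_nonneg)
    also have "(\<Prod>l\<in>J - {i}. \<Sum>x<S. ?b l x) = (\<Sum>x<S. \<alpha> j x) * (\<Prod>l\<in>J - {i} - {j}. \<Sum>x<S. ?b l x)"
      using i j finite_J by (subst prod.remove[of "J - {i}" j]) auto
    also have "(\<Prod>l\<in>J - {i} - {j}. \<Sum>x<S. ?b l x) = (\<Prod>l\<in>J - {i} - {j}. real S)"
      by (rule prod.cong) auto
    also have "\<dots> = real S ^ (card J - 2)" using cJi by simp
    also have "4 * ((\<Sum>x<S. \<alpha> j x) * real S ^ (card J - 2)) \<le> 4 * (4 * real S ^ (card J - 2))"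
      using \<alpha>4[OF j] by (intro mult_left_mono mult_right_mono) auto
    finally show ?thesis by simp
  qed
  have T4: "(\<Sum>s\<in>?P. \<alpha> j (s j) * peak (weight s / q (s j))) \<le> 16 * real S ^ (card J - 2)"
    using bnd2[of "\<lambda>x. 1 / q x"] N_pos by simp
  have T5: "(\<Sum>s\<in>?P. \<alpha> j (s j) * peak (weight s / sqrt (q (s j)))) \<le> 16 * real S ^ (card J - 2)"
    using bnd2[of "\<lambda>x. 1 / sqrt (q x)"] N_pos by simp
  have "(\<Sum>s\<in>?P. peak_sum s j) \<le> 3 * 4 ^ card J + 32 * real S ^ (card J - 2)"
    unfolding peak_sum_def sum.distrib using T1 T2 T3 T4 T5 by linarith
  also have "\<dots> \<le> 3 * 4 ^ card J * real S ^ (card J - 2) + 2 * 4 ^ card J * real S ^ (card J - 2)"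
  proof (intro add_mono)
    have "(4 :: real) ^ 2 \<le> 4 ^ card J" using card_J by (intro power_increasing) auto
    then show "32 * real S ^ (card J - 2) \<le> 2 * 4 ^ card J * real S ^ (card J - 2)"
      by (intro mult_right_mono) auto
    show "3 * 4 ^ card J \<le> 3 * 4 ^ card J * real S ^ (card J - 2)"
      using S by (simp add: one_le_power)
  qed
  finally show ?thesis by simp
qed

text \<open>All coordinates of the vectors are at most 1 in modulus, so a product above \<tau> has
  every factor above \<tau>, and only levels below \<open>S\<close> occur. Within a tuple each
  product is at most \<open>weight s * \<tau>\<close>.\<close>

lemma heavy_sum_le:
  assumes S: "S \<ge> 1" "(1/2) ^ S \<le> \<tau>"
  shows "(\<Sum>w\<in>{w\<in>\<Omega>. B w \<and> \<tau> < (\<Prod>j\<in>J. \<bar>y j (\<pi> j w)\<bar>)}. \<Prod>j\<in>J. \<bar>y j (\<pi> j w)\<bar>)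
    \<le> (8 + 5 * C2 + C3) * (real (card J) * (5 * 4 ^ card J * real S ^ (card J - 2))) * (N * \<tau>)"
proof -
  let ?H = "{w\<in>\<Omega>. B w \<and> \<tau> < (\<Prod>j\<in>J. \<bar>y j (\<pi> j w)\<bar>)}"
  let ?v = "\<lambda>w. \<Prod>j\<in>J. \<bar>y j (\<pi> j w)\<bar>"
  let ?Q = "8 + 5 * C2 + C3"
  let ?P = "J \<rightarrow>\<^sub>E {..<S}"
  let ?F = "\<lambda>w. \<lambda>j\<in>J. dyadic_exponent \<bar>y j (\<pi> j w)\<bar>"
  have finH: "finite ?H" using finite_\<Omega> by simp
  have le1: "\<bar>y j u\<bar> \<le> 1" if "j \<in> J" "u \<in> I j" for j u
  proof -
    have "(y j u)\<^sup>2 \<le> (\<Sum>u\<in>I j. (y j u)\<^sup>2)" using that finite_I by (intro member_le_sum) auto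
    also have "\<dots> \<le> 1" by (rule y[OF that(1)])
    finally show ?thesis by (simp add: abs_square_le_1)
  qed
  have gt: "\<tau> < \<bar>y j (\<pi> j w)\<bar>" if "w \<in> ?H" "j \<in> J" for w j
  proof -
    have "?v w = \<bar>y j (\<pi> j w)\<bar> * (\<Prod>l\<in>J - {j}. \<bar>y l (\<pi> l w)\<bar>)"
      by (rule prod.remove[OF finite_J that(2)])
    also have "\<dots> \<le> \<bar>y j (\<pi> j w)\<bar> * 1"
      using that le1 proj by (intro mult_left_mono prod_le_1) auto
    finally show ?thesis using that by simp
  qed
  have lev: "\<pi> j w \<in> L j (?F w j)" "?F w j < S" if "w \<in> ?H" "j \<in> J" for w j
  proof -
    have yj: "0 < \<bar>y j (\<pi> j w)\<bar>" "\<bar>y j (\<pi> j w)\<bar> \<le> 1"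
      using gt[OF that] tau_pos le1[OF that(2)] proj that by auto
    note d = dyadic_exponent[OF yj]
    show "\<pi> j w \<in> L j (?F w j)" using d that proj by (simp add: dyadic_level_def)
    show "?F w j < S"
    proof (rule ccontr)
      assume "\<not> ?F w j < S"
      then have "(1/2 :: real) ^ ?F w j \<le> (1/2) ^ S" by (intro power_decreasing) auto
      then have "\<bar>y j (\<pi> j w)\<bar> \<le> (1/2) ^ S" using order_trans[OF d(2)] that by simp
      with gt[OF that] S(2) show False by linarith
    qed
  qed
  have "(\<Sum>w\<in>?H. ?v w) = (\<Sum>s\<in>?P. \<Sum>w\<in>{w\<in>?H. ?F w = s}. ?v w)"
    by (rule sum.group[symmetric]) (use finH finite_J lev in \<open>auto intro!: finite_PiE\<close>)
  \<comment> \<open>The coordinate that bounds a tuple varies with the tuple; adding up all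
    \<open>j\<close> costs a factor \<open>card J\<close>.\<close>
  also have "\<dots> \<le> (\<Sum>s\<in>?P. \<Sum>j\<in>J. ?Q * peak_sum s j * (N * \<tau>))"
  proof (rule sum_mono)
    fix s assume "s \<in> ?P"
    let ?X = "{w\<in>?H. ?F w = s}"
    have nn: "?Q * peak_sum s j * (N * \<tau>) \<ge> 0" for j
      using C peak_sum_nonneg[of s j] tau_pos by simp
    show "(\<Sum>w\<in>?X. ?v w) \<le> (\<Sum>j\<in>J. ?Q * peak_sum s j * (N * \<tau>))"
    proof (cases "?X = {}")
      case True
      then show ?thesis using nn by (simp only: sum.empty sum_nonneg)
    next
      case False
      have sub: "?X \<subseteq> {w \<in> box (\<lambda>j. L j (s j)). B w}" using lev(1) by (auto simp: box_def)
      have vle: "?v w \<le> weight s * \<tau>" if "w \<in> ?X" for w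
      proof -
        have "?v w \<le> (\<Prod>j\<in>J. (1/2) ^ s j)"
          using that sub by (intro prod_mono) (auto simp: box_def dyadic_level_def)
        also have "\<dots> = weight s * \<tau>" using tau_pos by (simp add: weight_def power_sum)
        finally show ?thesis .
      qed
      obtain w where w: "w \<in> ?X" using False by blast
      have "\<tau> < ?v w" using w by simp
      also have "\<dots> \<le> weight s * \<tau>" by (rule vle[OF w])
      finally have w1: "weight s > 1" using tau_pos by simp
      obtain j where j: "j \<in> J" "level_count s * weight s / N \<le> ?Q * peak_sum s j"
        using level_contribution_le[OF w1] by blast
      have "(\<Sum>w\<in>?X. ?v w) \<le> real (card ?X) * (weight s * \<tau>)"
        using vle by (intro sum_bounded_above)
      also have "\<dots> \<le> level_count s * (weight s * \<tau>)"
        unfolding level_count_def using sub finite_\<Omega> weight_pos[of s] tau_pos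
        by (intro mult_right_mono of_nat_mono card_mono) (auto simp: box_def)
      also have "\<dots> = level_count s * weight s / N * (N * \<tau>)" using N_pos by simp
      also have "\<dots> \<le> ?Q * peak_sum s j * (N * \<tau>)"
        using j tau_pos by (intro mult_right_mono) auto
      also have "\<dots> \<le> (\<Sum>j\<in>J. ?Q * peak_sum s j * (N * \<tau>))"
        using j finite_J nn by (intro member_le_sum) auto
      finally show ?thesis .
    qed
  qed
  also have "\<dots> = (\<Sum>j\<in>J. \<Sum>s\<in>?P. ?Q * peak_sum s j * (N * \<tau>))" by (rule sum.swap)
  also have "\<dots> = (\<Sum>j\<in>J. ?Q * (\<Sum>s\<in>?P. peak_sum s j) * (N * \<tau>))"
    by (simp only: sum_distrib_left sum_distrib_right)
  also have "\<dots> \<le> (\<Sum>j\<in>J. ?Q * (5 * 4 ^ card J * real S ^ (card J - 2)) * (N * \<tau>))"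
    using C tau_pos S by (intro sum_mono mult_right_mono mult_left_mono sum_peak_sum_le) auto
  also have "\<dots> = ?Q * (real (card J) * (5 * 4 ^ card J * real S ^ (card J - 2))) * (N * \<tau>)"
    by simp
  finally show ?thesis .
qed

end

end

subsection \<open>Light entries and the random bounds\<close>

text \<open>With \<open>x = M / N\<close>, the weight \<open>(1 / x) ^ M * x ^ card A\<close> is at
  least 1 for each admissible subset, and over all subsets the weights sum to
  \<open>(1 / x) ^ M * (1 + x) ^ card U\<close>, at most \<open>(N / M) ^ M * exp M\<close>.\<close>

lemma card_small_subsets_le:
  assumes "finite U" "card U \<le> N" "1 \<le> M" "M \<le> N"
  shows "real (card {A. A \<subseteq> U \<and> card A \<le> M}) \<le> exp (real M * (1 + ln (real N / real M)))"
proof -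
  define x where "x = real M / real N"
  have x: "0 < x" "x \<le> 1" using assms by (auto simp: x_def)
  have "real (card {A. A \<subseteq> U \<and> card A \<le> M}) = (\<Sum>A\<in>{A. A \<subseteq> U \<and> card A \<le> M}. 1)" by simp
  also have "\<dots> \<le> (\<Sum>A\<in>{A. A \<subseteq> U \<and> card A \<le> M}. (1 / x) ^ M * x ^ card A)"
  proof (rule sum_mono)
    fix A assume A: "A \<in> {A. A \<subseteq> U \<and> card A \<le> M}"
    then have "x ^ M \<le> x ^ card A" using x by (intro power_decreasing) auto
    then show "1 \<le> (1 / x) ^ M * x ^ card A" using x by (simp add: power_divide field_simps)
  qed
  also have "\<dots> \<le> (\<Sum>A\<in>Pow U. (1 / x) ^ M * x ^ card A)"
    using assms x by (intro sum_mono2) auto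
  also have "\<dots> = (1 / x) ^ M * (1 + x) ^ card U"
  proof -
    have "(\<Prod>u\<in>U. x + 1) = (\<Sum>A\<in>Pow U. x ^ card A)"
      using assms(1) prod_add[of U "\<lambda>_. x" "\<lambda>_. 1"] by simp
    then show ?thesis by (simp add: sum_distrib_left add.commute)
  qed
  also have "\<dots> \<le> (1 / x) ^ M * (1 + x) ^ N"
    using assms x by (intro mult_left_mono power_increasing) auto
  also have "\<dots> \<le> (1 / x) ^ M * exp x ^ N"
    using x exp_ge_add_one_self by (intro mult_left_mono power_mono) auto
  also have "exp x ^ N = exp (real M)"
    using assms by (simp add: x_def flip: exp_of_nat_mult)
  also have "(1 / x) ^ M = exp (real M * ln (real N / real M))"
    using assms by (simp add: x_def exp_of_nat_mult)
  also have "exp (real M * ln (real N / real M)) * exp (real M) = exp (real M * (1 + ln (real N / real M)))"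
    by (simp add: algebra_simps flip: exp_add)
  finally show ?thesis .
qed

text \<open>Turns decay in the entropy into powers of \<open>N\<close>, down to boxes with one-point
  sides. The difference of the two sides is
  \<open>(M - 1) * (ln N - ln M) + (M - ln M)\<close>.\<close>

lemma ln_le_entropy:
  assumes "1 \<le> M" "M \<le> N"
  shows "ln (real N) \<le> real M * (1 + ln (real N / real M))"
proof -
  have "ln (real M) * (real M - 1) \<le> ln (real N) * (real M - 1)"
    using assms by (intro mult_right_mono) auto
  moreover have "ln (real M) \<le> real M - 1" using assms by (intro ln_le_minus_one) auto
  ultimately show ?thesis using assms by (simp add: ln_div algebra_simps)
qed

section \<open>Light part, splitting of the form, and failure probabilities\<close>

context jointly_injective_projections begin

definition light_part :: "('w \<Rightarrow> real) \<Rightarrow> ('w \<Rightarrow> bool) \<Rightarrow> ('j \<Rightarrow> 'a \<Rightarrow> real) \<Rightarrow> real" where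
  "light_part T B y = (\<Sum>w\<in>\<Omega>. (if \<bar>\<Prod>j\<in>J. y j (\<pi> j w)\<bar> \<le> \<tau> then T w * (\<Prod>j\<in>J. y j (\<pi> j w)) else 0)
     * (of_bool (B w) - p))"

lemma sum_prod_squares_le_1:
  assumes "\<And>j. j \<in> J \<Longrightarrow> (\<Sum>u\<in>I j. (y j u)\<^sup>2) \<le> 1"
  shows "(\<Sum>w\<in>\<Omega>. (\<Prod>j\<in>J. y j (\<pi> j w))\<^sup>2) \<le> (1 :: real)"
proof -
  have "(\<Sum>w\<in>\<Omega>. (\<Prod>j\<in>J. y j (\<pi> j w))\<^sup>2) = (\<Sum>w\<in>\<Omega>. \<Prod>j\<in>J. (y j (\<pi> j w))\<^sup>2)"
    by (simp add: prod_power_distrib)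
  also have "\<dots> \<le> (\<Prod>j\<in>J. \<Sum>u\<in>I j. (y j u)\<^sup>2)" by (rule sum_prod_proj_le) simp
  also have "\<dots> \<le> 1" using assms by (intro prod_le_1) (auto intro: sum_nonneg)
  finally show ?thesis .
qed

text \<open>Divided by \<tau>, the truncated coefficients are at most 1 in modulus and their squares
  sum to at most \<open>1 / \<tau>\<^sup>2\<close>, so the exponent is at most
  \<open>p / \<tau>\<^sup>2 = N\<close>. The sign \<epsilon> covers both tails.\<close>

lemma light_part_tail:
  fixes C :: real
  assumes y: "\<And>j. j \<in> J \<Longrightarrow> (\<Sum>u\<in>I j. (y j u)\<^sup>2) \<le> 1" and T: "\<And>w. w \<in> \<Omega> \<Longrightarrow> \<bar>T w\<bar> \<le> 1"
  shows "measure_pmf.prob (sampling \<Omega> p) {B. C * (N * \<tau>) \<le> \<bar>light_part T B y\<bar>} \<le> 2 * exp ((1 - C) * N)"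
proof -
  let ?f = "\<lambda>w. \<Prod>j\<in>J. y j (\<pi> j w)"
  have one: "measure_pmf.prob (sampling \<Omega> p) {B. C * N \<le> \<epsilon> * light_part T B y / \<tau>} \<le> exp ((1 - C) * N)"
    if \<epsilon>: "\<epsilon> = 1 \<or> \<epsilon> = -1" for \<epsilon> :: real
  proof -
    define d where "d = (\<lambda>w. \<epsilon> * (if \<bar>?f w\<bar> \<le> \<tau> then T w * ?f w else 0) / \<tau>)"
    have d1: "\<bar>d w\<bar> \<le> 1" and d2: "(d w)\<^sup>2 \<le> (?f w)\<^sup>2 / \<tau>\<^sup>2" if "w \<in> \<Omega>" for w
    proof -
      have "\<bar>T w\<bar> * \<bar>?f w\<bar> \<le> 1 * \<bar>?f w\<bar>" using T[OF that] by (intro mult_right_mono) auto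
      then have *: "\<bar>d w\<bar> \<le> \<bar>?f w\<bar> / \<tau>" and **: "\<bar>?f w\<bar> > \<tau> \<Longrightarrow> d w = 0"
        using \<epsilon> tau_pos unfolding d_def by (auto simp: abs_mult divide_right_mono)
      show "\<bar>d w\<bar> \<le> 1"
      proof (cases "\<bar>?f w\<bar> \<le> \<tau>")
        case True
        then have "\<bar>?f w\<bar> / \<tau> \<le> 1" using tau_pos by simp
        with * show ?thesis by linarith
      qed (use ** in simp)
      have "\<bar>d w\<bar>\<^sup>2 \<le> (\<bar>?f w\<bar> / \<tau>)\<^sup>2" using * by (intro power_mono) auto
      then show "(d w)\<^sup>2 \<le> (?f w)\<^sup>2 / \<tau>\<^sup>2" by (simp add: power_divide)
    qed
    have eq: "(\<Sum>w\<in>\<Omega>. d w * (of_bool (B w) - p)) = \<epsilon> * light_part T B y / \<tau>" for B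
      unfolding light_part_def d_def by (simp add: sum_distrib_left sum_divide_distrib mult.assoc)
    have "measure_pmf.expectation (sampling \<Omega> p) (\<lambda>B. exp (\<epsilon> * light_part T B y / \<tau>))
        \<le> exp (p * (\<Sum>w\<in>\<Omega>. (d w)\<^sup>2))"
      using expectation_exp_centered_sampling[of \<Omega> p d] finite_\<Omega> p_pos p_le_1 d1 unfolding eq by simp
    also have "p * (\<Sum>w\<in>\<Omega>. (d w)\<^sup>2) \<le> p * (\<Sum>w\<in>\<Omega>. (?f w)\<^sup>2 / \<tau>\<^sup>2)"
      using d2 p_pos by (intro mult_left_mono sum_mono) auto
    also have "\<dots> = p / \<tau>\<^sup>2 * (\<Sum>w\<in>\<Omega>. (?f w)\<^sup>2)" by (simp flip: sum_divide_distrib)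
    also have "p / \<tau>\<^sup>2 = N" using p_eq tau_pos by (metis less_irrefl nonzero_mult_div_cancel_right power_not_zero)
    also have "N * (\<Sum>w\<in>\<Omega>. (?f w)\<^sup>2) \<le> real N * 1"
      using sum_prod_squares_le_1[of y] y by (intro mult_left_mono) auto
    finally have "measure_pmf.expectation (sampling \<Omega> p) (\<lambda>B. exp (\<epsilon> * light_part T B y / \<tau>)) \<le> exp (real N)"
      by simp
    then have "measure_pmf.prob (sampling \<Omega> p) {B. C * N \<le> \<epsilon> * light_part T B y / \<tau>} \<le> exp (real N) * exp (- (C * N))"
      by (intro exp_markov_pmf finite_set_pmf_Pi_pmf finite_\<Omega>) auto
    also have "\<dots> = exp ((1 - C) * N)" by (simp add: algebra_simps flip: exp_add)
    finally show ?thesis .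
  qed
  have "{B. C * (N * \<tau>) \<le> \<bar>light_part T B y\<bar>} \<subseteq>
      {B. C * N \<le> 1 * light_part T B y / \<tau>} \<union> {B. C * N \<le> (-1) * light_part T B y / \<tau>}"
    using tau_pos by (auto simp: field_simps abs_if split: if_splits)
  then have "measure_pmf.prob (sampling \<Omega> p) {B. C * (N * \<tau>) \<le> \<bar>light_part T B y\<bar>}
      \<le> measure_pmf.prob (sampling \<Omega> p) ({B. C * N \<le> 1 * light_part T B y / \<tau>} \<union> {B. C * N \<le> (-1) * light_part T B y / \<tau>})"
    by (intro measure_pmf.finite_measure_mono) auto
  also have "\<dots> \<le> measure_pmf.prob (sampling \<Omega> p) {B. C * N \<le> 1 * light_part T B y / \<tau>}
      + measure_pmf.prob (sampling \<Omega> p) {B. C * N \<le> (-1) * light_part T B y / \<tau>}"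
    by (intro measure_Un_le) auto
  also have "\<dots> \<le> exp ((1 - C) * N) + exp ((1 - C) * N)" by (intro add_mono one) auto
  finally show ?thesis by simp
qed

lemma form_le_light_part:
  assumes y: "\<And>j. j \<in> J \<Longrightarrow> (\<Sum>u\<in>I j. (y j u)\<^sup>2) \<le> 1" and T: "\<And>w. w \<in> \<Omega> \<Longrightarrow> \<bar>T w\<bar> \<le> 1"
    and C: "C2 \<ge> 0" "C3 \<ge> 0" and deg: "degree_bounded C3 B" and disc: "discrepancy_bounded C2 B"
    and S: "S \<ge> 1" "(1/2) ^ S \<le> \<tau>"
  shows "\<bar>form (\<lambda>w. T w * (of_bool (B w) - p)) y\<bar> \<le> \<bar>light_part T B y\<bar> + N * \<tau>
     + (8 + 5 * C2 + C3) * (real (card J) * (5 * 4 ^ card J * real S ^ (card J - 2))) * (N * \<tau>)"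
proof -
  let ?f = "\<lambda>w. \<Prod>j\<in>J. y j (\<pi> j w)"
  let ?h = "\<lambda>w. if \<tau> < \<bar>?f w\<bar> then \<bar>?f w\<bar> else 0"
  have absf: "\<bar>?f w\<bar> = (\<Prod>j\<in>J. \<bar>y j (\<pi> j w)\<bar>)" for w by (rule abs_prod)
  let ?g = "\<lambda>w. (if \<tau> < \<bar>?f w\<bar> then T w * ?f w else 0) * (of_bool (B w) - p)"
  have eq: "form (\<lambda>w. T w * (of_bool (B w) - p)) y = light_part T B y
      + (\<Sum>w\<in>\<Omega>. ?g w)"
    unfolding form_def light_part_def sum.distrib[symmetric] by (intro sum.cong) auto
  have "\<bar>\<Sum>w\<in>\<Omega>. ?g w\<bar> \<le> (\<Sum>w\<in>\<Omega>. ?h w * of_bool (B w) + p * ?h w)"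
  proof (rule order_trans[OF sum_abs], rule sum_mono)
    fix w assume w: "w \<in> \<Omega>"
    have "\<bar>T w\<bar> * \<bar>?f w\<bar> \<le> 1 * \<bar>?f w\<bar>" using T[OF w] by (intro mult_right_mono) auto
    then have "\<bar>(if \<tau> < \<bar>?f w\<bar> then T w * ?f w else 0)\<bar> \<le> ?h w" by (simp add: abs_mult)
    moreover have "\<bar>of_bool (B w) - p\<bar> \<le> of_bool (B w) + p" using p_pos by auto
    ultimately have "\<bar>(if \<tau> < \<bar>?f w\<bar> then T w * ?f w else 0) * (of_bool (B w) - p)\<bar> \<le> ?h w * (of_bool (B w) + p)"
      unfolding abs_mult by (intro mult_mono) auto
    then show "\<bar>(if \<tau> < \<bar>?f w\<bar> then T w * ?f w else 0) * (of_bool (B w) - p)\<bar> \<le> ?h w * of_bool (B w) + p * ?h w"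
      by (simp add: algebra_simps)
  qed
  also have "\<dots> = (\<Sum>w\<in>\<Omega>. ?h w * of_bool (B w)) + p * (\<Sum>w\<in>\<Omega>. ?h w)"
    by (simp add: sum.distrib sum_distrib_left)
  finally have gh: "\<bar>\<Sum>w\<in>\<Omega>. ?g w\<bar> \<le> (\<Sum>w\<in>\<Omega>. ?h w * of_bool (B w)) + p * (\<Sum>w\<in>\<Omega>. ?h w)" .
  have "(\<Sum>w\<in>\<Omega>. ?h w * of_bool (B w)) = (\<Sum>w\<in>{w\<in>\<Omega>. B w \<and> \<tau> < \<bar>?f w\<bar>}. \<bar>?f w\<bar>)"
    using finite_\<Omega> by (intro sum.mono_neutral_cong_right) auto
  also have "\<dots> \<le> (8 + 5 * C2 + C3) * (real (card J) * (5 * 4 ^ card J * real S ^ (card J - 2))) * (N * \<tau>)"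
    unfolding absf by (rule heavy_sum_le[OF y C deg disc S])
  finally have heavy: "(\<Sum>w\<in>\<Omega>. ?h w * of_bool (B w)) \<le> (8 + 5 * C2 + C3) * (real (card J) * (5 * 4 ^ card J * real S ^ (card J - 2))) * (N * \<tau>)" .
  \<comment> \<open>A modulus above \<tau> is at most its square divided by \<tau>, and the squares
    sum to at most 1.\<close>
  have "p * (\<Sum>w\<in>\<Omega>. ?h w) \<le> p * (\<Sum>w\<in>\<Omega>. (?f w)\<^sup>2 / \<tau>)"
  proof (intro mult_left_mono sum_mono)
    fix w
    have "\<tau> * \<bar>?f w\<bar> \<le> \<bar>?f w\<bar> * \<bar>?f w\<bar>" if "\<tau> < \<bar>?f w\<bar>" using that by (intro mult_right_mono) auto
    then show "?h w \<le> (?f w)\<^sup>2 / \<tau>"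
      using tau_pos by (simp add: pos_le_divide_eq power2_eq_square mult.commute flip: abs_mult)
  qed (use p_pos in auto)
  also have "p * (\<Sum>w\<in>\<Omega>. (?f w)\<^sup>2 / \<tau>) = p * (\<Sum>w\<in>\<Omega>. (?f w)\<^sup>2) / \<tau>" by (simp flip: sum_divide_distrib)
  also have "\<dots> \<le> p * 1 / \<tau>"
    using sum_prod_squares_le_1[OF y] p_pos tau_pos by (intro divide_right_mono mult_left_mono) auto
  also have "p * 1 / \<tau> = N * \<tau>"
  proof -
    have "p = N * \<tau> * \<tau>" using p_eq by (simp add: power2_eq_square)
    then have "p / \<tau> = N * \<tau> * \<tau> / \<tau>" by (rule arg_cong)
    then show ?thesis using tau_pos by simp
  qed
  finally have mean: "p * (\<Sum>w\<in>\<Omega>. ?h w) \<le> N * \<tau>" .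
  show ?thesis
    unfolding eq using abs_triangle_ineq[of "light_part T B y" "\<Sum>w\<in>\<Omega>. ?g w"] gh heavy mean by linarith
qed

text \<open>Points of a fibre differ in one coordinate only, so it has at most \<open>N\<close> of
  them. In the constant, 2 dominates \<open>exp 1 - 1\<close> from the choice \<open>l = 1\<close>;
  the rest turns \<open>N * p \<ge> c * ln N\<close> into \<open>N powr - (b + 2 * card J)\<close>,
  where \<open>2 * card J\<close> pays for the union over
  \<open>J \<times> \<Omega>\<close>.\<close>

lemma prob_not_degree_bounded:
  fixes b c :: real
  assumes c: "c > 0" "N * p \<ge> c * ln (real N)" and b: "b \<ge> 0"
  shows "measure_pmf.prob (sampling \<Omega> p) {B. \<not> degree_bounded (2 + (b + 2 * real (card J)) / c) B} \<le> N powr - b"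
proof -
  let ?C = "2 + (b + 2 * real (card J)) / c"
  let ?S = "\<lambda>j w0. {w\<in>\<Omega>. \<forall>l\<in>J - {j}. \<pi> l w = \<pi> l w0}"
  let ?E = "\<lambda>(j, w0). {B. ?C * (N * p) \<le> real (card {w\<in>?S j w0. B w})}"
  have card_S: "card (?S j w0) \<le> N" if "j \<in> J" for j w0
  proof -
    have "inj_on (\<pi> j) (?S j w0)"
    proof (rule inj_onI)
      fix w w' assume *: "w \<in> ?S j w0" "w' \<in> ?S j w0" "\<pi> j w = \<pi> j w'"
      have "\<pi> l w = \<pi> l w'" if "l \<in> J" for l using * that by (cases "l = j") auto
      with * show "w = w'" by (intro proj_inj) auto
    qed
    then have "card (?S j w0) \<le> card (I j)"
      using proj that finite_I[OF that] by (intro card_inj_on_le[of "\<pi> j"]) auto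
    with card_I[OF that] show ?thesis by simp
  qed
  have one: "measure_pmf.prob (sampling \<Omega> p) (?E f) \<le> N powr - (b + 2 * real (card J))" if "f \<in> J \<times> \<Omega>" for f
  proof -
    obtain j w0 where f: "f = (j, w0)" "j \<in> J" using \<open>f \<in> J \<times> \<Omega>\<close> by auto
    have "measure_pmf.prob (sampling \<Omega> p) (?E f) \<le> exp (N * p * (exp 1 - 1) - 1 * (?C * (N * p)))"
      unfolding f case_prod_conv using card_S[OF f(2)] p_pos p_le_1 finite_\<Omega>
      by (intro sampling_chernoff) (auto simp: mult.commute mult_left_mono)
    also have "\<dots> \<le> exp (- (b + 2 * real (card J)) * ln (real N))"
    proof -
      define d where "d = (b + 2 * real (card J)) / c"
      have d: "d * (c * ln (real N)) = (b + 2 * real (card J)) * ln (real N)" using c by (simp add: d_def)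
      have "d \<ge> 0" using b c by (simp add: d_def)
      have "N * p * (exp 1 - 1) \<le> N * p * 2"
        using e_less_272 p_pos by (intro mult_left_mono) auto
      moreover have "d * (N * p) \<ge> d * (c * ln (real N))"
        using c \<open>d \<ge> 0\<close> by (intro mult_left_mono) auto
      ultimately have "N * p * (exp 1 - 1) - 1 * ((2 + d) * (N * p)) \<le> - (b + 2 * real (card J)) * ln (real N)"
        using d by (simp add: algebra_simps)
      then show ?thesis by (simp add: d_def)
    qed
    also have "\<dots> = N powr - (b + 2 * real (card J))" using N_pos by (simp add: powr_def)
    finally show ?thesis .
  qed
  have "measure_pmf.prob (sampling \<Omega> p) {B. \<not> degree_bounded ?C B} \<le> measure_pmf.prob (sampling \<Omega> p) (\<Union>f\<in>J \<times> \<Omega>. ?E f)"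
  proof (rule measure_pmf.finite_measure_mono)
    show "{B. \<not> degree_bounded ?C B} \<subseteq> (\<Union>f\<in>J \<times> \<Omega>. ?E f)"
      unfolding degree_bounded_def by (fastforce simp: mult.assoc conj_ac)
  qed simp
  also have "\<dots> \<le> real (card (J \<times> \<Omega>)) * N powr - (b + 2 * real (card J))"
    using finite_J finite_\<Omega> one by (intro prob_UN_le_card_mult) auto
  also have "\<dots> \<le> N powr (2 * card J) * N powr - (b + 2 * real (card J))"
  proof (rule mult_right_mono)
    have "card J \<le> 2 ^ card J" by (simp add: less_imp_le)
    also have "\<dots> \<le> N ^ card J" using N_ge_2 by (intro power_mono) auto
    finally have "card (J \<times> \<Omega>) \<le> N ^ card J * N ^ card J"
      unfolding card_cartesian_product using card_\<Omega>_le by (intro mult_mono) auto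
    then have "real (card (J \<times> \<Omega>)) \<le> real (N ^ (2 * card J))"
      by (simp only: of_nat_le_iff mult_2 power_add)
    also have "\<dots> = N powr (2 * card J)" using N_pos by (simp flip: powr_realpow)
    finally show "real (card (J \<times> \<Omega>)) \<le> N powr (2 * card J)" .
  qed simp
  also have "\<dots> = N powr - b" by (simp flip: powr_add)
  finally show ?thesis .
qed

text \<open>Of \<open>2 * card J + 2 + b\<close>, one \<open>card J\<close> pays for the choice of
  the sides, the other for the possible counts, and 2 for the choice of \<open>M\<close> and a
  factor 2. The outer 2 offsets the half in the entropic tail.\<close>

lemma prob_not_discrepancy_bounded:
  fixes b :: real
  assumes b: "b \<ge> 0"
  shows "measure_pmf.prob (sampling \<Omega> p) {B. \<not> discrepancy_bounded (2 * (2 * real (card J) + 2 + b)) B} \<le> N powr - b"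
proof -
  let ?K = "card J"
  let ?\<beta> = "real ?K + 2 + b"
  let ?C = "2 * (2 * real ?K + 2 + b)"
  let ?H = "\<lambda>M. real M * (1 + ln (real N / real M))"
  let ?Ds = "\<lambda>M. PiE J (\<lambda>j. {A. A \<subseteq> I j \<and> A \<noteq> {} \<and> card A \<le> M})"
  define e where "e = (\<lambda>D B. real (card {w \<in> box D. B w}))"
  define \<mu> where "\<mu> = (\<lambda>D :: 'j \<Rightarrow> 'a set. p * (\<Prod>j\<in>J. real (card (D j))))"
  let ?E = "\<lambda>M D. {B. \<not> (e D B \<le> exp 2 * \<mu> D \<or> e D B * ln (e D B / \<mu> D) \<le> ?C * ?H M)}"
  have H: "?H M \<ge> ln (real N)" if "M \<in> {1..N}" for M using that by (intro ln_le_entropy) auto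
  have card1: "real (card \<Omega> + 1) \<le> 2 * N powr ?K"
  proof -
    have "card \<Omega> + 1 \<le> 2 * N ^ ?K" using card_\<Omega>_le N_ge_2 one_le_power[of N ?K] by linarith
    then have "real (card \<Omega> + 1) \<le> real (2 * N ^ ?K)" by (simp only: of_nat_le_iff)
    then show ?thesis using N_pos by (simp add: powr_realpow)
  qed
  have fin_sub: "finite {A. A \<subseteq> I j \<and> A \<noteq> {} \<and> card A \<le> M}" if "j \<in> J" for j M
    by (rule finite_subset[of _ "Pow (I j)"]) (use finite_I[OF that] in auto)
  have one: "measure_pmf.prob (sampling \<Omega> p) (?E M D) \<le> 2 * N powr ?K * exp (- (2 * real ?K + 2 + b) * ?H M)"
    if D: "D \<in> ?Ds M" for M D
  proof -
    have DI: "D j \<subseteq> I j" "D j \<noteq> {}" if "j \<in> J" for j using D that by (auto simp: PiE_iff)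
    have "card (D j) > 0" if "j \<in> J" for j
      using DI[OF that] finite_I[OF that] by (meson card_gt_0_iff finite_subset)
    then have \<mu>: "\<mu> D > 0" unfolding \<mu>_def using p_pos by (intro mult_pos_pos prod_pos) auto
    \<comment> \<open>The count occurs inside the logarithm of its own bound; fixing its integer
      value \<open>t\<close> turns the bad event into plain tail events.\<close>
    let ?ts = "{t \<in> {..card \<Omega>}. exp 2 * \<mu> D \<le> real t \<and> ?C * ?H M \<le> real t * ln (real t / \<mu> D)}"
    have "?E M D \<subseteq> (\<Union>t\<in>?ts. {B. real t \<le> e D B})"
    proof
      fix B assume B: "B \<in> ?E M D"
      have "card {w \<in> box D. B w} \<le> card \<Omega>" using finite_\<Omega> by (intro card_mono) (auto simp: box_def)
      then have "card {w \<in> box D. B w} \<in> ?ts" using B by (auto simp: e_def)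
      then show "B \<in> (\<Union>t\<in>?ts. {B. real t \<le> e D B})" unfolding e_def by blast
    qed
    then have "measure_pmf.prob (sampling \<Omega> p) (?E M D) \<le> measure_pmf.prob (sampling \<Omega> p) (\<Union>t\<in>?ts. {B. real t \<le> e D B})"
      by (intro measure_pmf.finite_measure_mono) auto
    also have "\<dots> \<le> real (card ?ts) * exp (- (2 * real ?K + 2 + b) * ?H M)"
    proof (rule prob_UN_le_card_mult)
      fix t assume t: "t \<in> ?ts"
      have "measure_pmf.prob (sampling \<Omega> p) {B. real t \<le> e D B} \<le> exp (- real t * ln (real t / \<mu> D) / 2)"
        unfolding e_def using t \<mu> p_pos p_le_1 finite_\<Omega> card_box_le[of D] DI
        by (intro sampling_chernoff_entropy) (auto simp: box_def \<mu>_def mult_left_mono)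
      also have "\<dots> \<le> exp (- (2 * real ?K + 2 + b) * ?H M)"
      proof -
        have "2 * ((2 * real ?K + 2 + b) * ?H M) \<le> real t * ln (real t / \<mu> D)"
          using t by (simp only: mem_Collect_eq mult.assoc)
        then show ?thesis unfolding exp_le_cancel_iff mult_minus_left by linarith
      qed
      finally show "measure_pmf.prob (sampling \<Omega> p) {B. real t \<le> e D B} \<le> exp (- (2 * real ?K + 2 + b) * ?H M)" .
    qed simp
    also have "\<dots> \<le> 2 * N powr ?K * exp (- (2 * real ?K + 2 + b) * ?H M)"
    proof (rule mult_right_mono)
      have "card ?ts \<le> card {..card \<Omega>}" by (intro card_mono) auto
      with card1 show "real (card ?ts) \<le> 2 * N powr ?K" by simp
    qed simp
    finally show ?thesis .
  qed
  have two: "measure_pmf.prob (sampling \<Omega> p) (\<Union>D\<in>?Ds M. ?E M D) \<le> 2 * N powr ?K * N powr - ?\<beta>"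
    if M: "M \<in> {1..N}" for M
  proof -
    have "measure_pmf.prob (sampling \<Omega> p) (\<Union>D\<in>?Ds M. ?E M D)
        \<le> real (card (?Ds M)) * (2 * N powr ?K * exp (- (2 * real ?K + 2 + b) * ?H M))"
      using finite_J fin_sub one by (intro prob_UN_le_card_mult finite_PiE) auto
    also have "\<dots> \<le> exp (?H M) ^ ?K * (2 * N powr ?K * exp (- (2 * real ?K + 2 + b) * ?H M))"
    proof (rule mult_right_mono)
      have "real (card (?Ds M)) = (\<Prod>j\<in>J. real (card {A. A \<subseteq> I j \<and> A \<noteq> {} \<and> card A \<le> M}))"
        using finite_J by (simp add: card_PiE)
      also have "\<dots> \<le> (\<Prod>j\<in>J. exp (?H M))"
      proof (intro prod_mono conjI)
        fix j assume j: "j \<in> J"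
        have "card {A. A \<subseteq> I j \<and> A \<noteq> {} \<and> card A \<le> M} \<le> card {A. A \<subseteq> I j \<and> card A \<le> M}"
          using finite_I[OF j] by (intro card_mono) auto
        also have "real \<dots> \<le> exp (?H M)"
          using finite_I[OF j] card_I[OF j] M by (intro card_small_subsets_le) auto
        finally show "real (card {A. A \<subseteq> I j \<and> A \<noteq> {} \<and> card A \<le> M}) \<le> exp (?H M)" by simp
      qed simp
      finally show "real (card (?Ds M)) \<le> exp (?H M) ^ ?K" by simp
    qed simp
    also have "\<dots> = 2 * N powr ?K * exp (- ?\<beta> * ?H M)"
      by (simp add: algebra_simps flip: exp_of_nat_mult exp_add)
    also have "\<dots> \<le> 2 * N powr ?K * exp (- ?\<beta> * ln (real N))"
      using H[OF M] b by (intro mult_left_mono) (auto intro!: mult_left_mono)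
    also have "exp (- ?\<beta> * ln (real N)) = N powr - ?\<beta>" using N_pos by (simp add: powr_def)
    finally show ?thesis .
  qed
  have "measure_pmf.prob (sampling \<Omega> p) {B. \<not> discrepancy_bounded ?C B}
      \<le> measure_pmf.prob (sampling \<Omega> p) (\<Union>M\<in>{1..N}. \<Union>D\<in>?Ds M. ?E M D)"
  proof (rule measure_pmf.finite_measure_mono)
    show "{B. \<not> discrepancy_bounded ?C B} \<subseteq> (\<Union>M\<in>{1..N}. \<Union>D\<in>?Ds M. ?E M D)"
      unfolding discrepancy_bounded_def Let_def e_def \<mu>_def by (auto simp: mult.assoc)
  qed simp
  also have "\<dots> \<le> real (card {1..N}) * (2 * N powr ?K * N powr - ?\<beta>)"
    using two by (intro prob_UN_le_card_mult) auto
  also have "\<dots> \<le> N powr 1 * (N powr 1 * N powr ?K * N powr - ?\<beta>)"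
    using N_ge_2 by (intro mult_mono) auto
  also have "\<dots> = N powr - b" by (simp only: powr_add[symmetric]) simp
  finally show ?thesis .
qed

end

subsection \<open>Concentration of multilinear forms\<close>

definition level_const :: "real \<Rightarrow> real" where
  "level_const c = (3 + \<bar>ln (c * ln 2)\<bar>) / ln 2"

text \<open>\<open>5 * K + b + 2\<close> is for the light part, 1 for the mean of the heavy part,
  and the last summand for the sampled heavy part, with the discrepancy and degree constants
  inserted.\<close>

definition net_const :: "nat \<Rightarrow> real \<Rightarrow> real \<Rightarrow> real" where
  "net_const K c b = 5 * K + b + 3 +
     (8 + 5 * (2 * (2 * K + 2 + b)) + (2 + (b + 2 * K) / c)) * (K * (5 * 4 ^ K))"

text \<open>\<open>2 ^ K\<close> is the passage from the net to the ball. With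
  \<open>b = r + 2\<close>, three exceptional events of probability \<open>N powr - b\<close> fit
  into \<open>N powr - r\<close>, since \<open>3 \<le> N\<^sup>2\<close>.\<close>

definition concentration_const :: "nat \<Rightarrow> real \<Rightarrow> real \<Rightarrow> real" where
  "concentration_const K c r = 2 ^ K * net_const K c (r + 2) * level_const c ^ (K - 2)"

lemma level_const_pos: "level_const c > 0"
  by (simp add: level_const_def)

lemma net_const_pos: "c > 0 \<Longrightarrow> b > 0 \<Longrightarrow> net_const K c b > 0"
  unfolding net_const_def by (rule add_pos_nonneg) (auto intro!: mult_nonneg_nonneg add_nonneg_nonneg)

lemma concentration_const_pos: "c > 0 \<Longrightarrow> r > 0 \<Longrightarrow> concentration_const K c r > 0"
  by (simp add: concentration_const_def net_const_pos level_const_pos)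

context jointly_injective_projections begin

lemma N_tau: "N * \<tau> = sqrt (N * p)"
proof -
  have "(N * \<tau>)\<^sup>2 = N * (N * \<tau>\<^sup>2)" by (simp add: power2_eq_square)
  also have "\<dots> = N * p" by (simp only: p_eq[symmetric])
  finally show ?thesis using tau_pos by (metis less_eq_real_def mult_nonneg_nonneg of_nat_0_le_iff real_sqrt_unique)
qed

text \<open>\<open>S\<close> is about \<open>log 2 (1 / \<tau>)\<close>, and
  \<open>N * p \<ge> c * ln 2\<close> makes \<open>1 / \<tau>\<close> at most a constant times
  \<open>N\<close>. Additive constants are absorbed through \<open>ln N \<ge> ln 2\<close>.\<close>

lemma number_of_levels:
  assumes c: "c > 0" "N * p \<ge> c * ln N"
  obtains S :: nat where "S \<ge> 1" "(1/2) ^ S \<le> \<tau>" "real S \<le> level_const c * ln N"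
proof -
  define x where "x = log 2 (1 / \<tau>)"
  define S where "S = nat \<lceil>x\<rceil> + 1"
  define X where "X = \<bar>ln (c * ln 2)\<bar>"
  have lnN: "ln 2 \<le> ln N" using N_ge_2 by simp
  have l2: "ln 2 \<ge> (1/2 :: real)" using ln2_ge_two_thirds by linarith
  have "\<tau> \<le> 1" using p_le_1 N_ge_2 by (simp add: \<tau>_def)
  then have x0: "x \<ge> 0" using tau_pos by (simp add: x_def)
  have "(2 :: real) powr x = 1 / \<tau>" using tau_pos by (simp add: x_def)
  moreover have "(2 :: real) powr x \<le> 2 powr S" by (intro powr_mono) (auto simp: S_def, linarith)
  ultimately have "1 / \<tau> \<le> 2 ^ S" by (simp add: powr_realpow)
  then have S2: "(1/2) ^ S \<le> \<tau>" using tau_pos by (simp add: power_one_over field_simps)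
  have "x * ln 2 = ln (1 / \<tau>)" by (simp add: x_def log_def)
  also have "\<dots> = ln (N / p) / 2"
    using p_pos N_pos by (simp add: \<tau>_def ln_div ln_sqrt field_simps)
  also have "\<dots> \<le> (2 * ln N - ln (c * ln 2)) / 2"
  proof -
    have "c * ln 2 \<le> N * p" using lnN c by (smt (verit) mult_left_mono)
    then have "ln (c * ln 2) \<le> ln (N * p)" using c p_pos N_pos by (subst ln_le_cancel_iff) auto
    then show ?thesis using p_pos N_pos by (simp add: ln_div ln_mult)
  qed
  also have "\<dots> \<le> ln N + X / 2" by (simp add: X_def)
  finally have xl: "x * ln 2 \<le> ln N + X / 2" .
  have "real S \<le> x + 2" using x0 unfolding S_def by linarith
  then have "real S * ln 2 \<le> (x + 2) * ln 2" by (intro mult_right_mono) auto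
  also have "\<dots> \<le> ln N + (X / 2 + 2 * ln 2)" using xl by (simp add: algebra_simps)
  finally have "real S \<le> (ln N + (X / 2 + 2 * ln 2)) / ln 2" by (simp add: pos_le_divide_eq)
  also have "\<dots> \<le> ((3 + X) * ln N) / ln 2"
  proof (rule divide_right_mono)
    have "X / 2 \<le> X * ln N" using l2 lnN mult_left_mono[of "1/2" "ln N" X] by (simp add: X_def)
    then show "ln N + (X / 2 + 2 * ln 2) \<le> (3 + X) * ln N" using lnN by (simp add: algebra_simps)
  qed simp
  also have "\<dots> = level_const c * ln N" by (simp add: level_const_def X_def)
  finally show thesis by (intro that[of S] S2) (simp_all add: S_def)
qed

text \<open>As \<open>64 \<le> exp 5\<close>, there are at most \<open>exp (5 * card J * N)\<close>
  tuples of net points; another \<open>exp N\<close> covers the factor 2 of the two tails, and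
  \<open>exp (- b * N)\<close> is left.\<close>

lemma prob_net_light_part:
  assumes T: "\<And>w. w \<in> \<Omega> \<Longrightarrow> \<bar>T w\<bar> \<le> 1" and b: "b \<ge> 0"
  shows "measure_pmf.prob (sampling \<Omega> p)
     (\<Union>z\<in>PiE J (\<lambda>j. ball_net (I j) N). {B. (5 * real (card J) + b + 2) * (N * \<tau>) \<le> \<bar>light_part T B z\<bar>})
     \<le> N powr - b"
proof -
  let ?Z = "PiE J (\<lambda>j. ball_net (I j) N)" and ?C = "5 * real (card J) + b + 2"
  have "measure_pmf.prob (sampling \<Omega> p) (\<Union>z\<in>?Z. {B. ?C * (N * \<tau>) \<le> \<bar>light_part T B z\<bar>})
      \<le> real (card ?Z) * (2 * exp ((1 - ?C) * N))"
    using finite_J finite_I T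
    by (intro prob_UN_le_card_mult finite_PiE finite_ball_net light_part_tail ball_net_norm N_pos)
      (auto simp: PiE_iff N_pos)
  also have "\<dots> \<le> exp (5 * real (card J) * N) * (exp N * exp ((1 - ?C) * N))"
  proof (intro mult_mono)
    have "real (card ?Z) = (\<Prod>j\<in>J. real (card (ball_net (I j) N)))" using finite_J by (simp add: card_PiE)
    also have "\<dots> \<le> (\<Prod>j\<in>J. 64 ^ N)"
      using card_ball_net[OF finite_I card_I] by (intro prod_mono) auto
    also have "\<dots> = 64 ^ (N * card J)" by (simp add: power_mult)
    also have "\<dots> \<le> exp 5 ^ (N * card J)"
    proof (rule power_mono)
      have "(64 :: real) \<le> 2.5 ^ 5" by (simp add: power_divide)
      also have "\<dots> \<le> exp 1 ^ 5" using exp_lower_Taylor_quadratic[of 1] by (intro power_mono) auto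
      finally show "64 \<le> exp (5 :: real)" by (simp flip: exp_of_nat_mult)
    qed simp
    also have "\<dots> = exp (5 * real (card J) * N)" by (simp add: ac_simps flip: exp_of_nat_mult)
    finally show "real (card ?Z) \<le> exp (5 * real (card J) * N)" .
    have "2 \<le> 1 + real N" using N_ge_2 by simp
    also have "\<dots> \<le> exp N" by (rule exp_ge_add_one_self)
    finally show "2 \<le> exp (real N)" .
  qed auto
  also have "\<dots> = exp (- b * N)" by (simp add: algebra_simps flip: exp_add)
  also have "\<dots> \<le> exp (- b * ln N)"
  proof -
    have "ln N \<le> real N" using ln_le_minus_one[of N] N_pos by linarith
    then show ?thesis using b by (simp add: mult_left_mono)
  qed
  also have "\<dots> = N powr - b" using N_pos by (simp add: powr_def)
  finally show ?thesis .
qed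

theorem form_concentration:
  fixes c r :: real
  assumes c: "c > 0" "N * p \<ge> c * ln N" and r: "r > 0" and T: "\<And>w. w \<in> \<Omega> \<Longrightarrow> \<bar>T w\<bar> \<le> 1"
  shows "measure_pmf.prob (sampling \<Omega> p)
      {B. \<forall>y. (\<forall>j\<in>J. (\<Sum>u\<in>I j. (y j u)\<^sup>2) \<le> 1) \<longrightarrow> \<bar>form (\<lambda>w. T w * (of_bool (B w) - p)) y\<bar>
         \<le> concentration_const (card J) c r * sqrt (N * p) * ln N ^ (card J - 2)} \<ge> 1 - N powr - r"
proof -
  let ?K = "card J" and ?Z = "PiE J (\<lambda>j. ball_net (I j) N)"
  define b where "b = r + 2"
  define C1 where "C1 = 5 * real ?K + b + 2"
  define C2 where "C2 = 2 * (2 * real ?K + 2 + b)"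
  define C3 where "C3 = 2 + (b + 2 * real ?K) / c"
  have b: "b > 0" using r by (simp add: b_def)
  have C: "C2 \<ge> 0" "C3 \<ge> 0" "C1 \<ge> 0" using b c by (auto simp: C1_def C2_def C3_def)
  let ?HC = "(8 + 5 * C2 + C3) * (real ?K * (5 * 4 ^ ?K))"
  have nc: "net_const ?K c b = C1 + 1 + ?HC" by (simp add: net_const_def C1_def C2_def C3_def)
  obtain S :: nat where S: "S \<ge> 1" "(1/2) ^ S \<le> \<tau>" "real S \<le> level_const c * ln N"
    using number_of_levels[OF c] by blast
  let ?E1 = "\<Union>z\<in>?Z. {B. C1 * (N * \<tau>) \<le> \<bar>light_part T B z\<bar>}"
  let ?E2 = "{B. \<not> discrepancy_bounded C2 B}"
  let ?E3 = "{B. \<not> degree_bounded C3 B}"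
  let ?G = "{B. \<forall>y. (\<forall>j\<in>J. (\<Sum>u\<in>I j. (y j u)\<^sup>2) \<le> 1) \<longrightarrow> \<bar>form (\<lambda>w. T w * (of_bool (B w) - p)) y\<bar>
         \<le> concentration_const ?K c r * sqrt (N * p) * ln N ^ (?K - 2)}"
  have "measure_pmf.prob (sampling \<Omega> p) (?E1 \<union> ?E2 \<union> ?E3) \<le> measure_pmf.prob (sampling \<Omega> p) ?E1
     + measure_pmf.prob (sampling \<Omega> p) ?E2 + measure_pmf.prob (sampling \<Omega> p) ?E3"
    by (rule order_trans[OF measure_Un_le add_right_mono[OF measure_Un_le]]) auto
  also have "\<dots> \<le> N powr - b + N powr - b + N powr - b"
    unfolding C1_def C2_def C3_def using b c T
    by (intro add_mono prob_net_light_part prob_not_discrepancy_bounded prob_not_degree_bounded) auto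
  also have "\<dots> = 3 / (real N)\<^sup>2 * N powr - r"
    using N_pos by (simp add: b_def powr_diff powr_numeral divide_simps)
  also have "\<dots> \<le> 1 * N powr - r"
  proof (rule mult_right_mono)
    have "(2 :: real)\<^sup>2 \<le> (real N)\<^sup>2" using N_ge_2 by (intro power_mono) auto
    then show "3 / (real N)\<^sup>2 \<le> 1" using N_pos by simp
  qed simp
  finally have bad: "measure_pmf.prob (sampling \<Omega> p) (?E1 \<union> ?E2 \<union> ?E3) \<le> N powr - r" by simp
  have good: "B \<in> ?G" if B: "B \<notin> ?E1 \<union> ?E2 \<union> ?E3" for B
  proof -
    have "\<bar>form (\<lambda>w. T w * (of_bool (B w) - p)) y\<bar> \<le> 2 ^ ?K * (net_const ?K c b * real S ^ (?K - 2) * (N * \<tau>))"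
      if y: "\<And>j. j \<in> J \<Longrightarrow> (\<Sum>u\<in>I j. (y j u)\<^sup>2) \<le> 1" for y
    proof (rule form_le_net[OF _ y])
      fix z assume z: "z \<in> ?Z"
      have z1: "(\<Sum>u\<in>I j. (z j u)\<^sup>2) \<le> 1" if "j \<in> J" for j
        using z that by (intro ball_net_norm[OF _ N_pos(1)]) auto
      have "\<bar>form (\<lambda>w. T w * (of_bool (B w) - p)) z\<bar> \<le> \<bar>light_part T B z\<bar> + N * \<tau>
         + (8 + 5 * C2 + C3) * (real ?K * (5 * 4 ^ ?K * real S ^ (?K - 2))) * (N * \<tau>)"
        using B by (intro form_le_light_part z1 T C S) auto
      moreover have "\<bar>light_part T B z\<bar> \<le> C1 * (N * \<tau>)" using B z by force
      moreover have "(C1 + 1) * 1 * (N * \<tau>) \<le> (C1 + 1) * real S ^ (?K - 2) * (N * \<tau>)"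
        using C S tau_pos by (intro mult_right_mono mult_left_mono one_le_power) auto
      ultimately show "\<bar>form (\<lambda>w. T w * (of_bool (B w) - p)) z\<bar> \<le> net_const ?K c b * real S ^ (?K - 2) * (N * \<tau>)"
        unfolding nc by (simp add: algebra_simps)
    qed auto
    moreover have "2 ^ ?K * (net_const ?K c b * real S ^ (?K - 2) * (N * \<tau>))
        \<le> 2 ^ ?K * (net_const ?K c b * (level_const c * ln N) ^ (?K - 2) * (N * \<tau>))"
      using S net_const_pos[OF c(1) b, of ?K] tau_pos by (intro mult_left_mono mult_right_mono power_mono) auto
    moreover have "\<dots> = concentration_const ?K c r * sqrt (N * p) * ln N ^ (?K - 2)"
      unfolding N_tau by (simp add: concentration_const_def b_def power_mult_distrib)
    ultimately show ?thesis by (force intro: order_trans)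
  qed
  have "1 - N powr - r \<le> 1 - measure_pmf.prob (sampling \<Omega> p) (?E1 \<union> ?E2 \<union> ?E3)" using bad by simp
  also have "\<dots> = measure_pmf.prob (sampling \<Omega> p) (- (?E1 \<union> ?E2 \<union> ?E3))"
    using measure_pmf.prob_compl[of "?E1 \<union> ?E2 \<union> ?E3" "sampling \<Omega> p"] by (simp add: Compl_eq_Diff_UNIV)
  also have "\<dots> \<le> measure_pmf.prob (sampling \<Omega> p) ?G"
    by (rule measure_pmf.finite_measure_mono) (use good in auto)
  finally show ?thesis .
qed

end

subsection \<open>Unfolding into blocks\<close>

text \<open>Carries events about Boolean samples over to the law of the sampled tensor; the map
  applied at an index depends on it through the entry \<open>T i\<close>.\<close>

lemma Pi_pmf_map_dependent:
  assumes "finite A"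
  shows "Pi_pmf A d' (\<lambda>i. map_pmf (f i) (q i)) =
    map_pmf (\<lambda>B i. if i \<in> A then f i (B i) else d') (Pi_pmf A d q)"
proof -
  have "Pi_pmf A d' (\<lambda>i. map_pmf (f i) (q i)) = Pi_pmf A d' (\<lambda>i. q i \<bind> (\<lambda>x. return_pmf (f i x)))"
    by (simp add: map_pmf_def)
  also have "\<dots> = Pi_pmf A d q \<bind> (\<lambda>B. return_pmf (\<lambda>i. if i \<in> A then f i (B i) else d'))"
    using assms by (subst Pi_pmf_bind[where d' = d]) auto
  finally show ?thesis by (simp add: map_pmf_def)
qed

text \<open>Consecutive runs of \<open>m\<close> positions; the shift \<open>j - 1\<close> is there
  because positions start at 1, and the last run may be shorter.\<close>

definition block :: "nat \<Rightarrow> nat \<Rightarrow> nat \<Rightarrow> nat set" where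
  "block k m b = {j \<in> {1..k}. (j - 1) div m = b}"

lemma finite_block: "finite (block k m b)"
  by (simp add: block_def)

lemma card_block_le:
  assumes "m \<ge> 1"
  shows "card (block k m b) \<le> m"
proof -
  have "block k m b \<subseteq> {b * m + 1..<b * m + 1 + m}"
  proof
    fix j assume "j \<in> block k m b"
    then have "j \<ge> 1" "b * m + (j - 1) mod m = j - 1" using div_mult_mod_eq[of "j - 1" m] by (auto simp: block_def)
    moreover have "(j - 1) mod m < m" using assms by simp
    ultimately show "j \<in> {b * m + 1..<b * m + 1 + m}" unfolding atLeastLessThan_iff by linarith
  qed
  then have "card (block k m b) \<le> card {b * m + 1..<b * m + 1 + m}" by (intro card_mono) auto
  then show ?thesis by simp
qed

lemma finite_multi_indices: "finite (multi_indices k n)"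
  unfolding multi_indices_def by (intro finite_PiE) auto

lemma block_index_less:
  fixes j k m :: nat
  assumes "1 \<le> m" "j \<in> {1..k}"
  shows "(j - 1) div m < (k + m - 1) div m"
proof -
  have "(j - 1) div m + 1 = (j - 1 + m) div m"
    by (rule div_add_self2[symmetric]) (use assms(1) in simp)
  also have "\<dots> \<le> (k + m - 1) div m" using assms by (intro div_le_mono) auto
  finally show ?thesis by simp
qed

text \<open>Reading an index block by block turns an order-\<open>k\<close> tensor of dimension \<open>n\<close> into one of
  order \<open>\<lceil>k / m\<rceil>\<close> and dimension \<open>n ^ m\<close>.\<close>
lemma block_projections:
  assumes m: "1 \<le> m" "m < k" and n: "n \<ge> 2" and p: "0 < p" "p \<le> 1"
  shows "jointly_injective_projections (multi_indices k n) {..<(k + m - 1) div m}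
    (\<lambda>b. PiE (block k m b) (\<lambda>_. {1..n})) (\<lambda>b i. restrict i (block k m b)) (n ^ m) p"
proof
  show "2 \<le> card {..<(k + m - 1) div m}" using m by (simp add: less_eq_div_iff_mult_less_eq)
  show "card (PiE (block k m b) (\<lambda>_. {1..n})) \<le> n ^ m" for b
    using n card_block_le[OF m(1), of k b] by (simp add: card_PiE finite_block power_increasing)
  show "restrict i (block k m b) \<in> PiE (block k m b) (\<lambda>_. {1..n})" if "i \<in> multi_indices k n" for i b
    using that by (auto simp: multi_indices_def block_def)
  show "i = i'" if i: "i \<in> multi_indices k n" "i' \<in> multi_indices k n"
    and eq: "\<And>b. b \<in> {..<(k + m - 1) div m} \<Longrightarrow> restrict i (block k m b) = restrict i' (block k m b)" for i i'
  proof (rule PiE_ext)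
    show "i \<in> {1..k} \<rightarrow>\<^sub>E {1..n}" "i' \<in> {1..k} \<rightarrow>\<^sub>E {1..n}" using i by (simp_all add: multi_indices_def)
    fix j assume j: "j \<in> {1..k}"
    have "(j - 1) div m < (k + m - 1) div m" by (rule block_index_less[OF m(1) j])
    then have "restrict i (block k m ((j - 1) div m)) j = restrict i' (block k m ((j - 1) div m)) j"
      using eq by simp
    then show "i j = i' j" using j by (simp add: block_def)
  qed
  show "2 \<le> n ^ m" using n m self_le_power[of n m] by simp
qed (use p finite_multi_indices finite_block in \<open>auto intro: finite_PiE\<close>)

section \<open>From multilinear forms to the spectral norm\<close>

lemma abs_le_max_entry:
  assumes "i \<in> multi_indices k n"
  shows "\<bar>T i\<bar> \<le> max_entry k n T"
  unfolding max_entry_def using assms finite_multi_indices by (intro Max_ge) auto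

lemma spectral_norm_le:
  assumes "n \<ge> 1"
    and "\<And>x. (\<And>j. j \<in> {1..k} \<Longrightarrow> L2_set (x j) {1..n} = 1) \<Longrightarrow>
      \<bar>\<Sum>i\<in>multi_indices k n. T i * (\<Prod>j\<in>{1..k}. x j (i j))\<bar> \<le> b"
  shows "spectral_norm k n T \<le> b"
  unfolding spectral_norm_def
proof (rule cSUP_least)
  \<comment> \<open>The first basis vector in every slot shows that the supremum is over a nonempty
    set; this is where \<open>n \<ge> 1\<close> enters.\<close>
  have "L2_set (\<lambda>u. if u = 1 then 1 else 0) {1..n} = 1"
    using assms(1) sum.delta[of "{1..n}" 1 "\<lambda>_. 1 :: real"]
    by (simp add: L2_set_def if_distrib[of "\<lambda>x. x\<^sup>2"] cong: if_cong)
  then have "(\<lambda>_ u. if u = 1 then 1 else 0) \<in> {x :: nat \<Rightarrow> nat \<Rightarrow> real. \<forall>j\<in>{1..k}. L2_set (x j) {1..n} = 1}" by simp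
  then show "{x :: nat \<Rightarrow> nat \<Rightarrow> real. \<forall>j\<in>{1..k}. L2_set (x j) {1..n} = 1} \<noteq> {}"
    by (rule ex_in_conv[THEN iffD1, OF exI])
qed (use assms in auto)

lemma sampled_tensor_concentration:
  fixes p c r :: real
  assumes m: "1 \<le> m" "m < k" and n: "n \<ge> 2" and p: "p \<le> 1" "p \<ge> c * ln n / n ^ m"
    and c: "c > 0" and r: "r > 0"
  defines "K \<equiv> (k + m - 1) div m"
  shows "measure_pmf.prob (sampled_tensor k n T p)
     {X. spectral_norm k n (\<lambda>i. X i - p * T i) \<le> max_entry k n T *
        (concentration_const K (c / k) r * sqrt (n ^ m * p) * (m * ln n) ^ (K - 2))} \<ge> 1 - n powr - r"
proof -
  let ?J = "{..<K}"
  let ?I = "\<lambda>b. PiE (block k m b) (\<lambda>_. {1..n})"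
  let ?\<pi> = "\<lambda>b i. restrict i (block k m b)"
  have "c * ln (real n) / real n ^ m > 0" using c n by simp
  then have p0: "p > 0" using p by linarith
  interpret jointly_injective_projections "multi_indices k n" ?J ?I ?\<pi> "n ^ m" p
    unfolding K_def by (rule block_projections[OF m n p0 p(1)])
  define t where "t = max_entry k n T"
  \<comment> \<open>If \<open>t = 0\<close>, division returns 0 and \<open>T\<close> vanishes on all
    multi-indices, so \<open>T i = t * T' i\<close> holds there as well.\<close>
  define T' where "T' = (\<lambda>i. T i / t)"
  have Tt: "\<bar>T i\<bar> \<le> t" if "i \<in> multi_indices k n" for i
    unfolding t_def by (rule abs_le_max_entry[OF that])
  have T'1: "\<bar>T' i\<bar> \<le> 1" if "i \<in> multi_indices k n" for i
    using Tt[OF that] by (auto simp: T'_def divide_le_eq)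
  have TT': "T i = t * T' i" if "i \<in> multi_indices k n" for i
    using Tt[OF that] by (cases "t = 0") (auto simp: T'_def)
  have t0: "t \<ge> 0"
  proof -
    have "(\<lambda>j\<in>{1..k}. 1) \<in> multi_indices k n" using n by (auto simp: multi_indices_def)
    from Tt[OF this] show ?thesis by linarith
  qed
  let ?b = "concentration_const (card ?J) (c / k) r * sqrt (real (n ^ m) * p) * ln (real (n ^ m)) ^ (card ?J - 2)"
  let ?G = "{B. \<forall>y. (\<forall>j\<in>?J. (\<Sum>u\<in>?I j. (y j u)\<^sup>2) \<le> 1) \<longrightarrow> \<bar>form (\<lambda>w. T' w * (of_bool (B w) - p)) y\<bar> \<le> ?b}"
  let ?F = "\<lambda>B i. if i \<in> multi_indices k n then (if B i then T i else 0) else 0"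
  let ?A = "{X. spectral_norm k n (\<lambda>i. X i - p * T i) \<le> t * ?b}"
  have lnN: "ln (real (n ^ m)) = m * ln n" using n by (simp add: ln_realpow)
  have "1 - n powr - r \<le> 1 - real (n ^ m) powr - r"
  proof -
    have "real n \<le> real (n ^ m)" using n m self_le_power[of n m] by simp
    then show ?thesis using r n by (simp add: powr_mono2' del: of_nat_power)
  qed
  also have "\<dots> \<le> measure_pmf.prob (sampling (multi_indices k n) p) ?G"
  proof (rule form_concentration[OF _ _ r T'1])
    show "c / k > 0" using c m by simp
    \<comment> \<open>Dividing \<open>c\<close> by \<open>k\<close> makes up for
      \<open>ln (n ^ m) = m * ln n\<close> in a way that does not depend on
      \<open>m\<close>.\<close>
    have "c / k * ln (real (n ^ m)) = (m / k) * (c * ln n)" by (subst lnN) simp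
    also have "\<dots> \<le> 1 * (c * ln n)" using m c n by (intro mult_right_mono) auto
    also have "\<dots> \<le> real (n ^ m) * p" using p n by (simp add: field_simps)
    finally show "c / k * ln (real (n ^ m)) \<le> real (n ^ m) * p" .
  qed
  also have "\<dots> \<le> measure_pmf.prob (sampling (multi_indices k n) p) (?F -` ?A)"
  proof (rule measure_pmf.finite_measure_mono)
    show "?G \<subseteq> ?F -` ?A"
    proof
      fix B assume B: "B \<in> ?G"
      have "spectral_norm k n (\<lambda>i. ?F B i - p * T i) \<le> t * ?b"
      proof (rule spectral_norm_le)
        fix x :: "nat \<Rightarrow> nat \<Rightarrow> real"
        assume x: "\<And>j. j \<in> {1..k} \<Longrightarrow> L2_set (x j) {1..n} = 1"
        define y where "y = (\<lambda>b v. \<Prod>j\<in>block k m b. x j (v j))"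
        have "(\<Sum>v\<in>?I b. (y b v)\<^sup>2) \<le> 1" for b
        proof -
          have "(\<Sum>v\<in>?I b. (y b v)\<^sup>2) = (\<Prod>j\<in>block k m b. \<Sum>u\<in>{1..n}. (x j u)\<^sup>2)"
            unfolding y_def prod_power_distrib by (rule prod_sum_PiE[symmetric]) (auto simp: finite_block)
          also have "\<dots> = 1"
            using x by (intro prod.neutral) (auto simp: block_def L2_set_def)
          finally show ?thesis by simp
        qed
        then have form: "\<bar>form (\<lambda>w. T' w * (of_bool (B w) - p)) y\<bar> \<le> ?b" using B by simp
        have y: "(\<Prod>b\<in>?J. y b (?\<pi> b i)) = (\<Prod>j\<in>{1..k}. x j (i j))" for i
        proof -
          have "(\<Prod>b\<in>?J. y b (?\<pi> b i)) = (\<Prod>b\<in>?J. \<Prod>j\<in>block k m b. x j (i j))"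
            by (simp add: y_def)
          also have "\<dots> = (\<Prod>j\<in>{1..k}. x j (i j))"
            unfolding block_def by (rule prod.group) (use block_index_less[OF m(1)] K_def in auto)
          finally show ?thesis .
        qed
        have "(\<Sum>i\<in>multi_indices k n. (?F B i - p * T i) * (\<Prod>j\<in>{1..k}. x j (i j)))
            = t * form (\<lambda>w. T' w * (of_bool (B w) - p)) y"
          unfolding form_def y sum_distrib_left by (rule sum.cong) (auto simp: TT' algebra_simps)
        then show "\<bar>\<Sum>i\<in>multi_indices k n. (?F B i - p * T i) * (\<Prod>j\<in>{1..k}. x j (i j))\<bar> \<le> t * ?b"
          using form t0 by (simp add: abs_mult mult_left_mono)
      qed (use n in simp)
      then show "B \<in> ?F -` ?A" by simp
    qed
  qed simp
  also have "\<dots> = measure_pmf.prob (sampled_tensor k n T p) ?A"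
    unfolding sampled_tensor_def
    by (subst Pi_pmf_map_dependent[OF finite_multi_indices, where d = False]) simp
  finally show ?thesis unfolding lnN t_def by simp
qed

text \<open>At \<open>n = 2\<close> the logarithm is below 1 and a larger exponent lowers the power.
  The exponent grows by at most 1 and \<open>ln 2 \<ge> 1/2\<close>, so a factor 2 makes up for
  it.\<close>

lemma ln_power_le_powr:
  fixes d :: real
  assumes "n \<ge> (2 :: nat)" "real a \<le> d" "d \<le> real a + 1"
  shows "ln n ^ a \<le> 2 * ln n powr d"
proof -
  have l: "ln 2 \<le> ln (real n)" "ln (2::real) \<ge> 1/2" "ln (2::real) < 1"
    using assms ln2_ge_two_thirds ln2_le_25_over_36 by auto
  have "1 / 2 \<le> ln (2 :: real) powr 1" using l by simp
  also have "\<dots> \<le> ln (2 :: real) powr (d - a)"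
    using assms l by (intro powr_mono') auto
  also have "\<dots> \<le> ln n powr (d - a)" using assms l by (intro powr_mono2) auto
  finally have "ln n ^ a * (1 / 2) \<le> ln n powr a * ln n powr (d - a)"
    using l by (simp add: powr_realpow mult_left_mono)
  then show ?thesis by (simp flip: powr_add)
qed

theorem corollary3p3:
  fixes k :: nat and c r :: real
  assumes "k \<ge> 2" and "c > 0" and "r > 0"
  shows "\<exists>C>0. \<forall>(m::nat) (n::nat) (T :: (nat \<Rightarrow> nat) \<Rightarrow> real) (p::real).
           1 \<le> m \<and> m \<le> k - 1 \<and> n \<ge> 1 \<and> 0 \<le> p \<and> p \<le> 1 \<and> p \<ge> c * ln (real n) / real n ^ m \<longrightarrow>
           measure_pmf.prob (sampled_tensor k n T p)
             {X. spectral_norm k n (\<lambda>i. X i - p * T i) \<le>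
                 (if real k / 2 \<le> real m
                  then C * max_entry k n T * sqrt (real n ^ m * p)
                  else if real k / real m \<notin> \<int>
                  then C * max_entry k n T * sqrt (real n ^ m * p)
                         * ln (real n) powr ((real k - 1) / real m - 1)
                  else C * max_entry k n T * sqrt (real n ^ m * p)
                         * ln (real n) powr (real k / real m - 2))}
           \<ge> 1 - real n powr (- r)"
proof -
  \<comment> \<open>The order \<open>K\<close> varies with \<open>m\<close> but is at most
    \<open>k\<close>; summing over all such orders gives a constant that serves every
    \<open>m\<close>.\<close>
  define C0 where "C0 = (\<Sum>K\<le>k. concentration_const K (c / k) r)"
  \<comment> \<open>\<open>k ^ k\<close> absorbs the power \<open>m ^ (K - 2)\<close> that comes
    from \<open>ln (n ^ m)\<close>, and 2 the change of exponent of \<open>ln n\<close>.\<close>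
  define C where "C = 2 * real k ^ k * C0"
  have ck: "c / k > 0" using assms by simp
  have cc: "concentration_const K (c / k) r > 0" for K by (rule concentration_const_pos[OF ck assms(3)])
  have C0: "C0 > 0" unfolding C0_def by (rule sum_pos) (auto simp: cc)
  show ?thesis
  proof (intro exI[of _ C] conjI allI impI)
    show "C > 0" using C0 assms by (simp add: C_def)
    fix m n :: nat and T :: "(nat \<Rightarrow> nat) \<Rightarrow> real" and p :: real
    assume hyp: "1 \<le> m \<and> m \<le> k - 1 \<and> n \<ge> 1 \<and> 0 \<le> p \<and> p \<le> 1 \<and> p \<ge> c * ln (real n) / real n ^ m"
    let ?rhs = "if real k / 2 \<le> real m
                  then C * max_entry k n T * sqrt (real n ^ m * p)
                  else if real k / real m \<notin> \<int>
                  then C * max_entry k n T * sqrt (real n ^ m * p)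
                         * ln (real n) powr ((real k - 1) / real m - 1)
                  else C * max_entry k n T * sqrt (real n ^ m * p)
                         * ln (real n) powr (real k / real m - 2)"
    show "measure_pmf.prob (sampled_tensor k n T p)
        {X. spectral_norm k n (\<lambda>i. X i - p * T i) \<le> ?rhs} \<ge> 1 - real n powr (- r)"
    \<comment> \<open>For \<open>n = 1\<close> the required probability
      \<open>1 - 1 powr (- r)\<close> is 0.\<close>
    proof (cases "n = 1")
      case False
      then have n: "n \<ge> 2" using hyp by simp
      have m: "1 \<le> m" "m < k" using hyp assms by auto
      define K where "K = (k + m - 1) div m"
      have "K * m + (k + m - 1) mod m = k + m - 1" by (simp add: K_def)
      moreover have "(k + m - 1) mod m < m" using m by simp
      ultimately have Km: "K * m + 1 \<le> k + m" "k \<le> K * m" using m by linarith+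
      have "real (K * m + 1) \<le> real (k + m)" using Km(1) by (simp only: of_nat_le_iff)
      then have K_up: "real K \<le> (real k - 1) / m + 1" using m by (simp add: field_simps)
      have "real k \<le> real (K * m)" using Km(2) by (simp only: of_nat_le_iff)
      then have K_low: "real k / m \<le> K" using m by (simp add: field_simps)
      have K2: "K \<ge> 2" using m by (simp add: K_def less_eq_div_iff_mult_less_eq)
      have Kk: "K \<le> k"
      proof -
        have "(real k - 1) / m + 1 \<le> (real k - 1) / 1 + 1"
          using m by (intro add_right_mono divide_left_mono) auto
        with K_up show ?thesis by simp
      qed
      define t where "t = max_entry k n T"
      have t0: "t \<ge> 0"
      proof -
        have "(\<lambda>j\<in>{1..k}. 1) \<in> multi_indices k n" using n by (auto simp: multi_indices_def)
        from abs_le_max_entry[OF this, of T] show ?thesis by (simp add: t_def)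
      qed
      define s where "s = sqrt (real n ^ m * p)"
      have s0: "s \<ge> 0" using hyp by (simp add: s_def)
      have lnn: "ln (real n) \<ge> 0" using n by simp
      have base: "t * (concentration_const K (c / k) r * s * (m * ln n) ^ (K - 2))
          \<le> real k ^ k * C0 * t * s * ln n ^ (K - 2)"
      proof -
        have "concentration_const K (c / k) r \<le> C0"
          unfolding C0_def using cc Kk by (intro member_le_sum) (auto intro: less_imp_le)
        moreover have "real m ^ (K - 2) \<le> real k ^ k"
        proof -
          have "real m ^ (K - 2) \<le> real k ^ (K - 2)" using m by (intro power_mono) auto
          also have "\<dots> \<le> real k ^ k" using m Kk by (intro power_increasing) auto
          finally show ?thesis .
        qed
        ultimately have "concentration_const K (c / k) r * real m ^ (K - 2) \<le> C0 * real k ^ k"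
          using C0 by (intro mult_mono) auto
        then have "concentration_const K (c / k) r * real m ^ (K - 2) * (t * s * ln n ^ (K - 2))
            \<le> C0 * real k ^ k * (t * s * ln n ^ (K - 2))"
          using t0 s0 lnn by (intro mult_right_mono) auto
        then show ?thesis by (simp add: power_mult_distrib ac_simps)
      qed
      have pw: "real k ^ k * C0 * t * s * ln n ^ (K - 2) \<le> C * t * s * ln n powr d"
        if "real (K - 2) \<le> d" "d \<le> real (K - 2) + 1" for d
      proof -
        have "real k ^ k * C0 * t * s * ln n ^ (K - 2) \<le> real k ^ k * C0 * t * s * (2 * ln n powr d)"
          using ln_power_le_powr[OF n that] C0 t0 s0 by (intro mult_left_mono) auto
        then show ?thesis by (simp add: C_def ac_simps)
      qed
      have le: "t * (concentration_const K (c / k) r * s * (m * ln n) ^ (K - 2)) \<le> ?rhs"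
      proof (cases "real k / 2 \<le> real m")
        case True
        then have "real k / m \<le> 2" using m by (simp add: field_simps)
        moreover have "(real k - 1) / m < real k / m" using m by (simp add: divide_strict_right_mono)
        \<comment> \<open>Here \<open>K \<le> (k - 1) / m + 1 < 3\<close>, so the logarithmic factor
          has exponent 0.\<close>
        ultimately have "K = 2" using K_up K2 by linarith
        have "0 \<le> real k ^ k * C0 * t * s" using C0 t0 s0 by simp
        then have "real k ^ k * C0 * t * s \<le> C * t * s" by (simp add: C_def ac_simps)
        with base \<open>K = 2\<close> True show ?thesis by (simp add: t_def[symmetric] s_def[symmetric])
      next
        case F: False
        show ?thesis
        proof (cases "real k / real m \<in> \<int>")
          case True
          then obtain z where z: "real k / m = of_int z" by (elim Ints_cases)
          have "(real k - 1) / m < real k / m" using m by (simp add: divide_strict_right_mono)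
          then have "real_of_int (int K) < real_of_int z + 1" "real_of_int z \<le> real_of_int (int K)"
            using K_up K_low z by auto
          then have "int K = z" by linarith
          then have "real k / m - 2 = real (K - 2)" using z K2 by simp
          with base pw[of "real k / m - 2"] True F show ?thesis
            by (simp add: t_def[symmetric] s_def[symmetric])
        next
          case False
          have "(real k - 1) / m \<le> real k / m" using m by (simp add: divide_right_mono)
          \<comment> \<open>The claimed exponent lies between \<open>K - 2\<close> and
            \<open>K - 1\<close>: from \<open>K \<le> (k - 1) / m + 1\<close> on one side, and from
            \<open>(k - 1) / m \<le> k / m \<le> K\<close> on the other.\<close>
          then have "real (K - 2) \<le> (real k - 1) / m - 1" "(real k - 1) / m - 1 \<le> real (K - 2) + 1"
            using K_up K_low K2 by auto
          with base pw[of "(real k - 1) / m - 1"] False F show ?thesis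
            by (simp add: t_def[symmetric] s_def[symmetric])
        qed
      qed
      have "1 - real n powr - r \<le> measure_pmf.prob (sampled_tensor k n T p)
         {X. spectral_norm k n (\<lambda>i. X i - p * T i) \<le> t * (concentration_const K (c / k) r * s * (m * ln n) ^ (K - 2))}"
        unfolding K_def t_def s_def using hyp
        by (intro sampled_tensor_concentration m n assms) auto
      also have "\<dots> \<le> measure_pmf.prob (sampled_tensor k n T p)
         {X. spectral_norm k n (\<lambda>i. X i - p * T i) \<le> ?rhs}"
        by (rule measure_pmf.finite_measure_mono) (use le in \<open>auto intro: order_trans\<close>)
      finally show ?thesis .
    qed simp
  qed
qed

end
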